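(* Let $\Gamma_1$ and $\Gamma_2$ be finite 2-edge-connected graphs without loop edges (multiple edges allowed), with spanning trees $T_1$ and $T_2$ respectively. The following are equivalent: (1) The $q$-flow lattices are isomorphic: $\mathcal F_q(\Gamma_1,T_1)\cong \mathcal F_q(\Gamma_2,T_2)$. (2) There exists a cycle-preserving bijection $F:E(\Gamma_1)\to E(\Gamma_2)$ with $F(T_1)=T_2$. (3) The $q$-cut lattices are isomorphic: $\mathcal C_q(\Gamma_1,T_1)\cong \mathcal C_q(\Gamma_2,T_2)$.
   Context: Graphs are finite; 2-edge-connected means connected and remaining connected after removal of any one edge. Spanning trees are identified with their edge sets. A bijection of edge sets is cycle-preserving if a set of edges is the edge set of a (simple) cycle of $\Gamma_1$ if and only if its image is the edge set of a cycle of $\Gamma_2$. Let $\Gamma$ be such a graph with edge set $E$, spanning tree $T$, and an arbitrary fixed orientation of the edges. Let $\mathbb Z^E$ have the Euclidean inner product $\langle\cdot,\cdot\rangle$ with $E$ orthonormal. For $j\in E\setminus T$, the fundamental cycle $C_j\in\mathbb Z^E$ is the signed sum of the edges of the unique cycle in $T\cup\{j\}$, where this cycle is oriented in the direction of $j$ and an edge has sign $+1$ if its orientation agrees with that of the cycle and $-1$ otherwise. For $i\in T$, removing $i$ splits $T$ into two components, giving a vertex partition $V_{0,i}\sqcup V_{1,i}$ with $i$ directed from $V_{0,i}$ to $V_{1,i}$; the fundamental cut $K_i\in\mathbb Z^E$ is the sum of all edges of $\Gamma$ directed from $V_{0,i}$ to $V_{1,i}$ minus the sum of all edges directed from $V_{1,i}$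 to $V_{0,i}$. For $f\in\mathbb Z[q,q^{-1}]$ write $\bar f(q)=f(q^{-1})$. A form $\langle\cdot,\cdot\rangle$ on a $\mathbb Z[q,q^{-1}]$-module is sesquilinear if it is biadditive with $\langle \bar f x,y\rangle=f\langle x,y\rangle=\langle x,fy\rangle$. The $q$-flow lattice $\mathcal F_q(\Gamma,T)$ is the free $\mathbb Z[q,q^{-1}]$-module with basis $\{p_j\}_{j\in E\setminus T}$ and sesquilinear form determined by $\langle p_j,p_j\rangle=1+(\langle C_j,C_j\rangle-1)q^2$ and $\langle p_i,p_j\rangle=\langle C_i,C_j\rangle q^2$ for $i\ne j$. The $q$-cut lattice $\mathcal C_q(\Gamma,T)$ is the free $\mathbb Z[q,q^{-1}]$-module with basis $\{\ell_i\}_{i\in T}$ and sesquilinear form determined by $\langle \ell_i,\ell_i\rangle=1+(\langle K_i,K_i\rangle-1)q^2$ and $\langle \ell_i,\ell_j\rangle=\langle K_i,K_j\rangle q^2$ for $i\neq j$. (Both also carry the $q$-antilinear involution fixing the given basis.) Up to isomorphism these do not depend on the orientation. An isomorphism of $q$-lattices is a $\mathbb Z[q,q^{-1}]$-linear bijection preserving the sesquilinear forms; equivalently, the Gram matrices satisfy $A'=S^*AS$ for some $S$ invertible over $\mathbb Z[q,q^{-1}]$, where $S^*$ is the transpose of $S$ with $q\mapsto q^{-1}$ applied. *)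

theory Defs
  imports "Graph_Theory.Digraph_Component" "Graph_Theory.Arc_Walk" "HOL-Library.Poly_Mapping"
begin

text \<open>
  A graph with an arbitrary fixed orientation is a multi-digraph of the AFP entry Graph_Theory:
  each undirected edge is one arc, directed from its tail to its head. The notion
  \<^const>\<open>Digraph_Component.connected\<close> ignores the orientation, but \<^const>\<open>pre_digraph.cycle\<close>,
  \<^const>\<open>forest\<close> and \<^const>\<open>spanning_tree\<close> refer to directed cycles and are not used for the
  oriented graph itself. Undirected walks are arc walks in the following digraph, in which
  \<open>(e, True)\<close> traverses \<open>e\<close> along its orientation and \<open>(e, False)\<close> against it.
\<close>

definition undirect :: "('a, 'b) pre_digraph \<Rightarrow> ('a, 'b \<times> bool) pre_digraph" where
  "undirect G =
    \<lparr> verts = verts G,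
      arcs = arcs G \<times> UNIV,
      tail = (\<lambda>(e, d). if d then tail G e else head G e),
      head = (\<lambda>(e, d). if d then head G e else tail G e) \<rparr>"

text \<open>
  Distinctness of the edges excludes going along an edge and straight back; a pair of parallel
  edges does form a cycle.
\<close>

definition undirected_cycle :: "('a, 'b) pre_digraph \<Rightarrow> ('b \<times> bool) list \<Rightarrow> bool" where
  "undirected_cycle G p \<longleftrightarrow> pre_digraph.cycle (undirect G) p \<and> distinct (map fst p)"

definition cycle_edge_set :: "('a, 'b) pre_digraph \<Rightarrow> 'b set \<Rightarrow> bool" where
  "cycle_edge_set G S \<longleftrightarrow> (\<exists>p. undirected_cycle G p \<and> S = fst ` set p)"

definition cycle_preserving ::
    "('a, 'b) pre_digraph \<Rightarrow> ('c, 'd) pre_digraph \<Rightarrow> ('b \<Rightarrow> 'd) \<Rightarrow> bool" where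
  "cycle_preserving G H F \<longleftrightarrow>
    (\<forall>S \<subseteq> arcs G. cycle_edge_set G S \<longleftrightarrow> cycle_edge_set H (F ` S))"

definition two_edge_connected :: "('a, 'b) pre_digraph \<Rightarrow> bool" where
  "two_edge_connected G \<longleftrightarrow>
    Digraph_Component.connected G \<and>
    (\<forall>e \<in> arcs G. Digraph_Component.connected (pre_digraph.del_arc G e))"

definition spanning_tree_edges :: "('a, 'b) pre_digraph \<Rightarrow> 'b set \<Rightarrow> bool" where
  "spanning_tree_edges G T \<longleftrightarrow>
    T \<subseteq> arcs G \<and>
    Digraph_Component.connected (G\<lparr>arcs := T\<rparr>) \<and>
    (\<nexists>p. undirected_cycle (G\<lparr>arcs := T\<rparr>) p)"

text \<open>Elements of \<open>\<int>\<^sup>E\<close> are integer functions vanishing outside \<open>arcs G\<close>.\<close>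

definition edge_inner :: "('a, 'b) pre_digraph \<Rightarrow> ('b \<Rightarrow> int) \<Rightarrow> ('b \<Rightarrow> int) \<Rightarrow> int" where
  "edge_inner G x y = (\<Sum>e\<in>arcs G. x e * y e)"

definition signed_edge_sum :: "('b \<times> bool) list \<Rightarrow> 'b \<Rightarrow> int" where
  "signed_edge_sum p e = of_bool ((e, True) \<in> set p) - of_bool ((e, False) \<in> set p)"

text \<open>
  The cycle as a list is only unique up to rotation, hence the description is of the vector.
\<close>

definition fund_cycle :: "('a, 'b) pre_digraph \<Rightarrow> 'b set \<Rightarrow> 'b \<Rightarrow> 'b \<Rightarrow> int" where
  "fund_cycle G T j =
    (THE x. \<exists>p. undirected_cycle (G\<lparr>arcs := insert j T\<rparr>) p \<and> (j, True) \<in> set p \<and>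
                x = signed_edge_sum p)"

definition component_verts :: "('a, 'b) pre_digraph \<Rightarrow> 'b set \<Rightarrow> 'a \<Rightarrow> 'a set" where
  "component_verts G S v = {w. reachable (undirect (G\<lparr>arcs := S\<rparr>)) v w}"

definition fund_cut :: "('a, 'b) pre_digraph \<Rightarrow> 'b set \<Rightarrow> 'b \<Rightarrow> 'b \<Rightarrow> int" where
  "fund_cut G T i e =
    (let V0 = component_verts G (T - {i}) (tail G i);
         V1 = component_verts G (T - {i}) (head G i)
     in if e \<in> arcs G
        then of_bool (tail G e \<in> V0 \<and> head G e \<in> V1) - of_bool (tail G e \<in> V1 \<and> head G e \<in> V0)
        else 0)"

text \<open>
  Laurent polynomials over the integers: the coefficient function on exponents has finite support,
  and the ring multiplication of \<^type>\<open>poly_mapping\<close> is convolution.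
\<close>

type_synonym laurent = "int \<Rightarrow>\<^sub>0 int"

definition laurent_q :: laurent where
  "laurent_q = Poly_Mapping.single 1 1"

definition laurent_bar :: "laurent \<Rightarrow> laurent" where
  "laurent_bar f = Poly_Mapping.map_key uminus f"

record 'b q_lattice =
  vectors :: "('b \<Rightarrow> laurent) set"
  form :: "('b \<Rightarrow> laurent) \<Rightarrow> ('b \<Rightarrow> laurent) \<Rightarrow> laurent"
  involution :: "('b \<Rightarrow> laurent) \<Rightarrow> 'b \<Rightarrow> laurent"

text \<open>
  The free module on a finite set \<open>B\<close>, with the form that has Gram matrix \<open>A\<close> on the basis and is
  antilinear in the first argument, and with the antilinear involution fixing the basis.
\<close>

definition free_q_lattice :: "'b set \<Rightarrow> ('b \<Rightarrow> 'b \<Rightarrow> laurent) \<Rightarrow> 'b q_lattice" where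
  "free_q_lattice B A =
    \<lparr> vectors = {x. \<forall>b. b \<notin> B \<longrightarrow> x b = 0},
      form = (\<lambda>x y. \<Sum>i\<in>B. \<Sum>j\<in>B. laurent_bar (x i) * A i j * y j),
      involution = (\<lambda>x b. laurent_bar (x b)) \<rparr>"

definition q_flow_lattice :: "('a, 'b) pre_digraph \<Rightarrow> 'b set \<Rightarrow> 'b q_lattice" where
  "q_flow_lattice G T = free_q_lattice (arcs G - T)
    (\<lambda>i j. if i = j
           then 1 + of_int (edge_inner G (fund_cycle G T j) (fund_cycle G T j) - 1) * laurent_q ^ 2
           else of_int (edge_inner G (fund_cycle G T i) (fund_cycle G T j)) * laurent_q ^ 2)"

definition q_cut_lattice :: "('a, 'b) pre_digraph \<Rightarrow> 'b set \<Rightarrow> 'b q_lattice" where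
  "q_cut_lattice G T = free_q_lattice T
    (\<lambda>i j. if i = j
           then 1 + of_int (edge_inner G (fund_cut G T j) (fund_cut G T j) - 1) * laurent_q ^ 2
           else of_int (edge_inner G (fund_cut G T i) (fund_cut G T j)) * laurent_q ^ 2)"

text \<open>Isomorphisms need not commute with the involutions.\<close>

definition q_lattice_iso ::
    "'b q_lattice \<Rightarrow> 'd q_lattice \<Rightarrow> (('b \<Rightarrow> laurent) \<Rightarrow> 'd \<Rightarrow> laurent) \<Rightarrow> bool" where
  "q_lattice_iso L M \<phi> \<longleftrightarrow>
    bij_betw \<phi> (vectors L) (vectors M) \<and>
    (\<forall>x \<in> vectors L. \<forall>y \<in> vectors L. \<phi> (\<lambda>b. x b + y b) = (\<lambda>d. \<phi> x d + \<phi> y d)) \<and>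
    (\<forall>f. \<forall>x \<in> vectors L. \<phi> (\<lambda>b. f * x b) = (\<lambda>d. f * \<phi> x d)) \<and>
    (\<forall>x \<in> vectors L. \<forall>y \<in> vectors L. form M (\<phi> x) (\<phi> y) = form L x y)"

definition q_lattices_isomorphic :: "'b q_lattice \<Rightarrow> 'd q_lattice \<Rightarrow> bool" where
  "q_lattices_isomorphic L M \<longleftrightarrow> (\<exists>\<phi>. q_lattice_iso L M \<phi>)"

end

theory Submission
  imports Defs Complex_Main
begin

text \<open>
  Let \<open>D\<close> be the matrix whose rows are the tree edges \<open>i\<close>, whose columns are the other edges \<open>j\<close>,
  and whose entry is the coefficient of \<open>i\<close> in the fundamental cycle of \<open>j\<close>. Cycles are
  orthogonal to cuts, so the fundamental cut of \<open>i\<close> has coefficient \<open>- D i j\<close> at \<open>j\<close>. Hence the flow and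
  cut lattices have the Gram matrices \<open>1 + q\<^sup>2 D\<^sup>T D\<close> and \<open>1 + q\<^sup>2 D D\<^sup>T\<close>. Each of the three
  conditions of the theorem is equivalent to a fourth one that is invariant under transposition: the matrices
  of the two graphs agree up to permutations and sign changes of rows and columns
  (\<open>signed_equiv\<close>).

  An isomorphism of \<open>q\<close>-lattices with Gram matrices \<open>1 + q\<^sup>2 B\<close> and \<open>1 + q\<^sup>2 B'\<close> need not permute
  the bases up to sign, but it forces \<open>B\<close> and \<open>B'\<close> to differ by such a permutation. Indeed, at a primitive
  eighth root of unity \<open>\<zeta>\<close> we have \<open>q\<^sup>2 = \<i>\<close>, so the hermitian and antihermitian parts of the Gram matrices are
  preserved separately. The first makes the matrix of the isomorphism unitary over \<open>\<int>[\<zeta>]\<close>, which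
  leaves a single nonzero entry, a unit \<open>\<plusminus>\<zeta>\<^sup>r\<close>, in every column; by the second
  the powers of \<open>\<zeta>\<close> cancel (\<open>basis_image_of_iso\<close>, \<open>free_q_lattices_isomorphic_iff\<close>).

  The matrix \<open>D\<close> satisfies the criterion of Ghouila-Houri for total unimodularity: the required signings
  are the coboundaries of parity functions on the vertices (\<open>coeff_equitable\<close>). Its
  consequences for small minors suffice to recover \<open>D\<close> from \<open>B = D\<^sup>T D\<close>: if some
  row has no zeros on a set \<open>J\<close> of columns, in \<open>D\<close> or in another such matrix with the same \<open>B\<close>, then
  the number of these rows is the minimum of \<open>\<bar>B i j\<bar>\<close> over \<open>i, j \<in> J\<close> (\<open>count_superset_le\<close>). Inclusion-exclusion
  gives the number of rows with each support, and \<open>B\<close> gives their signs (\<open>rows_from_gram\<close>). No row of \<open>D\<close>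
  vanishes since the graph has no bridges, and no column since it has no loops.

  A cycle-preserving bijection that matches the trees maps fundamental cycles to fundamental cycles, so it
  matches the supports of the matrices; by Camion's theorem these determine the signs up to scaling of
  rows and columns (\<open>signing_unique\<close>). Conversely, a signed equivalence transports flows, and
  cycles are the minimal supports of nonzero flows (\<open>cycle_preserving_if_signed_equiv\<close>).
\<close>

section \<open>Integer matrices with unimodular small minors\<close>

text \<open>
  Entries in \<open>{-1, 0, 1}\<close>, and no \<open>2 \<times> 2\<close> or \<open>3 \<times> 3\<close> minor of one particular zero pattern equal
  to \<open>\<plusminus>2\<close>: a full \<open>2 \<times> 2\<close> submatrix must be singular, and a \<open>3 \<times> 3\<close> submatrix with
  zeros exactly on one transversal must have a sign product that makes its determinant vanish.
  These are consequences of total unimodularity, and unlike equitability they are visibly invariant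
  under transposition, which lets cuts be treated as flows with the two index sets exchanged.
\<close>

definition unimodular3 :: "'r set \<Rightarrow> 'c set \<Rightarrow> ('r \<Rightarrow> 'c \<Rightarrow> int) \<Rightarrow> bool" where
  "unimodular3 R C D \<longleftrightarrow>
    (\<forall>r\<in>R. \<forall>c\<in>C. D r c \<in> {-1, 0, 1}) \<and>
    (\<forall>r\<in>R. \<forall>s\<in>R. \<forall>i\<in>C. \<forall>j\<in>C. D r i \<noteq> 0 \<and> D r j \<noteq> 0 \<and> D s i \<noteq> 0 \<and> D s j \<noteq> 0
       \<longrightarrow> D r i * D r j = D s i * D s j) \<and>
    (\<forall>r\<in>R. \<forall>s\<in>R. \<forall>t\<in>R. \<forall>i\<in>C. \<forall>j\<in>C. \<forall>k\<in>C.
       D r i \<noteq> 0 \<and> D r j \<noteq> 0 \<and> D r k = 0 \<and> D s i \<noteq> 0 \<and> D s j = 0 \<and> D s k \<noteq> 0 \<and>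
       D t i = 0 \<and> D t j \<noteq> 0 \<and> D t k \<noteq> 0
       \<longrightarrow> (D r i * D r j) * (D s i * D s k) * (D t j * D t k) = -1)"

definition gram :: "'r set \<Rightarrow> ('r \<Rightarrow> 'c \<Rightarrow> int) \<Rightarrow> 'c \<Rightarrow> 'c \<Rightarrow> int" where
  "gram R D i j = (\<Sum>r\<in>R. D r i * D r j)"

text \<open>
  The criterion of Ghouila-Houri for total unimodularity: the columns of any subset can be signed
  so that their signed sum has entries in \<open>{-1, 0, 1}\<close>.
\<close>

definition equitable :: "'r set \<Rightarrow> 'c set \<Rightarrow> ('r \<Rightarrow> 'c \<Rightarrow> int) \<Rightarrow> bool" where
  "equitable R C D \<longleftrightarrow>
    (\<forall>J\<subseteq>C. \<exists>\<epsilon>. (\<forall>j. \<epsilon> j \<in> {-1, 1}) \<and> (\<forall>r\<in>R. (\<Sum>j\<in>J. \<epsilon> j * D r j) \<in> {-1, 0, 1}))"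

definition signed_equiv ::
  "'r set \<Rightarrow> 'c set \<Rightarrow> ('r \<Rightarrow> 'c \<Rightarrow> int) \<Rightarrow> 'p set \<Rightarrow> 'd set \<Rightarrow> ('p \<Rightarrow> 'd \<Rightarrow> int) \<Rightarrow> bool" where
  "signed_equiv R C D R' C' D' \<longleftrightarrow>
    (\<exists>\<rho> \<sigma> \<eta> \<epsilon>. bij_betw \<rho> R R' \<and> bij_betw \<sigma> C C' \<and>
      (\<forall>r. \<eta> r \<in> {-1, 1}) \<and> (\<forall>c. \<epsilon> c \<in> {-1, 1}) \<and>
      (\<forall>r\<in>R. \<forall>c\<in>C. D' (\<rho> r) (\<sigma> c) = \<eta> r * \<epsilon> c * D r c))"

definition forms_equiv :: "'c set \<Rightarrow> ('c \<Rightarrow> 'c \<Rightarrow> int) \<Rightarrow> 'd set \<Rightarrow> ('d \<Rightarrow> 'd \<Rightarrow> int) \<Rightarrow> bool" where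
  "forms_equiv C B C' B' \<longleftrightarrow>
    (\<exists>\<sigma> \<epsilon>. bij_betw \<sigma> C C' \<and> (\<forall>c. \<epsilon> c \<in> {-1, 1}) \<and>
      (\<forall>i\<in>C. \<forall>j\<in>C. B' (\<sigma> i) (\<sigma> j) = \<epsilon> i * \<epsilon> j * B i j))"

lemma unimodular3_entry: "unimodular3 R C D \<Longrightarrow> r \<in> R \<Longrightarrow> c \<in> C \<Longrightarrow> D r c \<in> {-1, 0, 1}"
  unfolding unimodular3_def by blast

lemma unimodular3_2:
  "unimodular3 R C D \<Longrightarrow> r \<in> R \<Longrightarrow> s \<in> R \<Longrightarrow> i \<in> C \<Longrightarrow> j \<in> C \<Longrightarrow>
   D r i \<noteq> 0 \<Longrightarrow> D r j \<noteq> 0 \<Longrightarrow> D s i \<noteq> 0 \<Longrightarrow> D s j \<noteq> 0 \<Longrightarrow> D r i * D r j = D s i * D s j"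
  unfolding unimodular3_def by blast

lemma unimodular3_3:
  "unimodular3 R C D \<Longrightarrow> r \<in> R \<Longrightarrow> s \<in> R \<Longrightarrow> t \<in> R \<Longrightarrow> i \<in> C \<Longrightarrow> j \<in> C \<Longrightarrow> k \<in> C \<Longrightarrow>
   D r i \<noteq> 0 \<Longrightarrow> D r j \<noteq> 0 \<Longrightarrow> D r k = 0 \<Longrightarrow> D s i \<noteq> 0 \<Longrightarrow> D s j = 0 \<Longrightarrow> D s k \<noteq> 0 \<Longrightarrow>
   D t i = 0 \<Longrightarrow> D t j \<noteq> 0 \<Longrightarrow> D t k \<noteq> 0 \<Longrightarrow>
   (D r i * D r j) * (D s i * D s k) * (D t j * D t k) = -1"
  unfolding unimodular3_def by blast

lemma unimodular3_transpose:
  assumes D: "unimodular3 R C D"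
  shows "unimodular3 C R (\<lambda>c r. D r c)"
  unfolding unimodular3_def
proof (intro conjI ballI impI; (elim conjE)?)
  fix c r assume "c \<in> C" "r \<in> R"
  then show "D r c \<in> {-1, 0, 1}" using unimodular3_entry[OF D] by blast
next
  fix i j r s assume m: "i \<in> C" "j \<in> C" "r \<in> R" "s \<in> R"
    and n: "D r i \<noteq> 0" "D s i \<noteq> 0" "D r j \<noteq> 0" "D s j \<noteq> 0"
  have "D r i * D r j = D s i * D s j" using unimodular3_2[OF D] m n by blast
  then show "D r i * D s i = D r j * D s j"
    using n unimodular3_entry[OF D m(3) m(1)] unimodular3_entry[OF D m(3) m(2)]
      unimodular3_entry[OF D m(4) m(1)] unimodular3_entry[OF D m(4) m(2)] by auto
next
  fix r s t i j k
  assume m: "r \<in> C" "s \<in> C" "t \<in> C" "i \<in> R" "j \<in> R" "k \<in> R"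
    and n: "D i r \<noteq> 0" "D j r \<noteq> 0" "D k r = 0" "D i s \<noteq> 0" "D j s = 0" "D k s \<noteq> 0"
       "D i t = 0" "D j t \<noteq> 0" "D k t \<noteq> 0"
  have "(D i r * D i s) * (D j r * D j t) * (D k s * D k t) = -1"
    using unimodular3_3[OF D, of i j k r s t] m n by blast
  then show "(D i r * D j r) * (D i s * D k s) * (D j t * D k t) = -1"
    by (simp add: ac_simps)
qed

lemma sum_pair: "i \<noteq> j \<Longrightarrow> (\<Sum>x\<in>{i, j}. f x) = f i + (f j :: int)"
  by simp

lemma sum_triple: "i \<noteq> j \<Longrightarrow> i \<noteq> k \<Longrightarrow> j \<noteq> k \<Longrightarrow> (\<Sum>x\<in>{i, j, k}. f x) = f i + f j + (f k :: int)"
  by simp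

lemma equitable_entry:
  assumes E: "equitable R C D" and m: "r \<in> R" "c \<in> C"
  shows "D r c \<in> {-1, 0, 1}"
proof -
  obtain e where "\<forall>j. e j \<in> {-1, 1::int}" "\<forall>r\<in>R. (\<Sum>j\<in>{c}. e j * D r j) \<in> {-1, 0, 1}"
    using E m unfolding equitable_def by (metis empty_subsetI insert_subset)
  then have "e c \<in> {-1, 1}" "e c * D r c \<in> {-1, 0, 1}" using m by auto
  then show ?thesis by auto
qed

lemma equitable_product:
  fixes a b x y :: int
  assumes "a \<in> {-1, 1}" "b \<in> {-1, 1}" "x \<in> {-1, 0, 1}" "y \<in> {-1, 0, 1}" "x \<noteq> 0" "y \<noteq> 0"
    "a * x + b * y \<in> {-1, 0, 1}"
  shows "x * y = - (a * b)"
  using assms by auto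

text \<open>
  In a row with exactly two nonzero entries in \<open>J\<close>, the signed sum is even, hence \<open>0\<close>, so the
  product of these entries is minus the product of the two signs. For \<open>|J| = 2\<close> this
  product is then the same in every such row; for \<open>|J| = 3\<close> each of the three signs occurs twice when the
  three products are multiplied.
\<close>

lemma equitable_unimodular3:
  assumes E: "equitable R C D"
  shows "unimodular3 R C D"
  unfolding unimodular3_def
proof (intro conjI ballI impI; (elim conjE)?)
  fix r c assume "r \<in> R" "c \<in> C"
  then show "D r c \<in> {-1, 0, 1}" using equitable_entry[OF E] by blast
next
  fix r s i j assume m: "r \<in> R" "s \<in> R" "i \<in> C" "j \<in> C"
    and n: "D r i \<noteq> 0" "D r j \<noteq> 0" "D s i \<noteq> 0" "D s j \<noteq> 0"
  note en = equitable_entry[OF E]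
  show "D r i * D r j = D s i * D s j"
  proof (cases "i = j")
    case True
    then show ?thesis using en[OF m(1,3)] en[OF m(2,3)] n by auto
  next
    case False
    obtain e where e: "\<forall>j. e j \<in> {-1, 1::int}"
      "\<forall>r\<in>R. (\<Sum>j\<in>{i, j}. e j * D r j) \<in> {-1, 0, 1}"
      using E m unfolding equitable_def by (metis empty_subsetI insert_subset)
    have "D r i * D r j = - (e i * e j)" if "r \<in> R" "D r i \<noteq> 0" "D r j \<noteq> 0" for r
      using equitable_product[of "e i" "e j" "D r i" "D r j"] e that False
        en[OF that(1) m(3)] en[OF that(1) m(4)] by (simp add: sum_pair)
    then show ?thesis using m n by simp
  qed
next
  fix r s t i j k
  assume m: "r \<in> R" "s \<in> R" "t \<in> R" "i \<in> C" "j \<in> C" "k \<in> C"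
    and n: "D r i \<noteq> 0" "D r j \<noteq> 0" "D r k = 0" "D s i \<noteq> 0" "D s j = 0" "D s k \<noteq> 0"
       "D t i = 0" "D t j \<noteq> 0" "D t k \<noteq> 0"
  note en = equitable_entry[OF E]
  have d: "i \<noteq> j" "i \<noteq> k" "j \<noteq> k" using n by auto
  obtain e where e: "\<forall>j. e j \<in> {-1, 1::int}"
    "\<forall>r\<in>R. (\<Sum>j\<in>{i, j, k}. e j * D r j) \<in> {-1, 0, 1}"
    using E m unfolding equitable_def by (metis empty_subsetI insert_subset)
  have sums: "e i * D r i + e j * D r j \<in> {-1, 0, 1}" "e i * D s i + e k * D s k \<in> {-1, 0, 1}"
    "e j * D t j + e k * D t k \<in> {-1, 0, 1}"
    using e(2)[rule_format, OF m(1)] e(2)[rule_format, OF m(2)] e(2)[rule_format, OF m(3)] n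
    by (simp_all add: sum_triple d)
  have "D r i * D r j = - (e i * e j)"
    by (rule equitable_product) (use e(1) en m n sums in blast)+
  moreover have "D s i * D s k = - (e i * e k)"
    by (rule equitable_product) (use e(1) en m n sums in blast)+
  moreover have "D t j * D t k = - (e j * e k)"
    by (rule equitable_product) (use e(1) en m n sums in blast)+
  moreover have "e i * e i = 1" "e j * e j = 1" "e k * e k = 1" using e(1)[rule_format, of i] e(1)[rule_format, of j] e(1)[rule_format, of k] by auto
  ultimately show "(D r i * D r j) * (D s i * D s k) * (D t j * D t k) = -1"
    using e(1)[rule_format, of i] e(1)[rule_format, of j] e(1)[rule_format, of k] by auto
qed

section \<open>Recovering the rows of a matrix from its Gram matrix\<close>

text \<open>
  All rows that are nonzero at both \<open>i\<close> and \<open>j\<close> contribute with the same sign to the Gram entry,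
  so nothing cancels.
\<close>

lemma gram_count:
  assumes D: "unimodular3 R C D" and fin: "finite R" and m: "s \<in> R" "i \<in> C" "j \<in> C"
    and n: "D s i \<noteq> 0" "D s j \<noteq> 0"
  shows "gram R D i j = D s i * D s j * int (card {r\<in>R. D r i \<noteq> 0 \<and> D r j \<noteq> 0})"
proof -
  let ?X = "{r\<in>R. D r i \<noteq> 0 \<and> D r j \<noteq> 0}"
  have "gram R D i j = (\<Sum>r\<in>?X. D r i * D r j)"
    unfolding gram_def by (rule sum.mono_neutral_right) (use fin in auto)
  also have "\<dots> = (\<Sum>r\<in>?X. D s i * D s j)"
    by (rule sum.cong) (use unimodular3_2[OF D _ m(1,2,3)] n in auto)
  finally show ?thesis by simp
qed

lemma abs_gram:
  assumes D: "unimodular3 R C D" and fin: "finite R" and m: "i \<in> C" "j \<in> C"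
  shows "\<bar>gram R D i j\<bar> = int (card {r\<in>R. D r i \<noteq> 0 \<and> D r j \<noteq> 0})"
proof (cases "\<exists>s\<in>R. D s i \<noteq> 0 \<and> D s j \<noteq> 0")
  case True
  then obtain s where s: "s \<in> R" "D s i \<noteq> 0" "D s j \<noteq> 0" by blast
  have "\<bar>D s i * D s j\<bar> = 1"
    using unimodular3_entry[OF D s(1) m(1)] unimodular3_entry[OF D s(1) m(2)] s by auto
  then show ?thesis using gram_count[OF D fin s(1) m s(2,3)] by (simp add: abs_mult)
next
  case False
  then have "gram R D i j = 0" unfolding gram_def by (intro sum.neutral) auto
  moreover have "{r\<in>R. D r i \<noteq> 0 \<and> D r j \<noteq> 0} = {}" using False by blast
  ultimately show ?thesis by (simp only: card.empty)
qed

lemma gram_sign: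
  assumes D: "unimodular3 R C D" and fin: "finite R" and m: "s \<in> R" "i \<in> C" "j \<in> C"
    and n: "D s i \<noteq> 0" "D s j \<noteq> 0"
  shows "D s i * D s j = sgn (gram R D i j)"
proof -
  have "s \<in> {r\<in>R. D r i \<noteq> 0 \<and> D r j \<noteq> 0}" using m n by blast
  then have "card {r\<in>R. D r i \<noteq> 0 \<and> D r j \<noteq> 0} > 0" using fin by (intro card_gt_0_iff[THEN iffD2]) auto
  moreover have "D s i * D s j \<in> {-1, 1}"
    using unimodular3_entry[OF D m(1) m(2)] unimodular3_entry[OF D m(1) m(3)] n by auto
  ultimately show ?thesis using gram_count[OF D fin m n] by (auto simp: sgn_if)
qed

text \<open>
  Suppose that some row of \<open>D\<close> is nonzero on all of \<open>J\<close>. Choose \<open>i, j \<in> J\<close> with \<open>\<bar>gram i j\<bar>\<close>,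
  the number of rows nonzero at \<open>i\<close> and \<open>j\<close>, minimal. Then every row of \<open>D'\<close> that is nonzero
  at \<open>i\<close> and \<open>j\<close> is nonzero on all of \<open>J\<close>: if one of them vanished at \<open>k\<close>, minimality would give a
  row with \<open>i, k\<close> but not \<open>j\<close>, and one with \<open>j, k\<close> but not \<open>i\<close>. The sign product of these three rows
  would be \<open>-1\<close> by the condition on minors, while the row of \<open>D\<close> shows that the signs of the
  three Gram entries multiply to \<open>1\<close>. So the count for \<open>D'\<close> is at least \<open>\<bar>gram i j\<bar>\<close>, and the count
  for \<open>D\<close> is at most that.
\<close>

lemma count_superset_le:
  assumes D: "unimodular3 R C D" "finite R" and D': "unimodular3 R' C D'" "finite R'"
    and g: "\<And>i j. i \<in> C \<Longrightarrow> j \<in> C \<Longrightarrow> gram R D i j = gram R' D' i j"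
    and J: "J \<subseteq> C" "J \<noteq> {}" "finite J"
  shows "card {r\<in>R. \<forall>i\<in>J. D r i \<noteq> 0} \<le> card {r\<in>R'. \<forall>i\<in>J. D' r i \<noteq> 0}"
proof (cases "\<exists>s\<in>R. \<forall>i\<in>J. D s i \<noteq> 0")
  case False
  then have "{r\<in>R. \<forall>i\<in>J. D r i \<noteq> 0} = {}" by blast
  then show ?thesis by (simp only: card.empty)
next
  case True
  then obtain s where s: "s \<in> R" "\<And>i. i \<in> J \<Longrightarrow> D s i \<noteq> 0" by blast
  define N where "N i j = {r\<in>R'. D' r i \<noteq> 0 \<and> D' r j \<noteq> 0}" for i j
  have finN: "finite (N i j)" for i j unfolding N_def using D'(2) by simp
  have cN: "card (N i j) = nat \<bar>gram R D i j\<bar>" if "i \<in> C" "j \<in> C" for i j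
    using abs_gram[OF D' that] g[OF that] unfolding N_def by simp
  \<comment> \<open>the case \<open>i = j\<close> is included; then any row missing \<open>k\<close> contradicts minimality at once\<close>
  have "\<exists>p\<in>J\<times>J. \<forall>q\<in>J\<times>J. card (N (fst p) (snd p)) \<le> card (N (fst q) (snd q))"
    using ex_min_if_finite[of "(\<lambda>q. card (N (fst q) (snd q))) ` (J \<times> J)"] J
    by (auto simp: not_less)
  then obtain i j where ij: "i \<in> J" "j \<in> J"
    and min: "\<And>k l. k \<in> J \<Longrightarrow> l \<in> J \<Longrightarrow> card (N i j) \<le> card (N k l)"
    by fastforce
  have escape: "\<exists>b\<in>N l k. D' b m = 0"
    if "l \<in> J" "k \<in> J" "a \<in> N i j" "D' a k = 0" "N l m \<subseteq> N i j" for a l k m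
  proof (rule ccontr)
    assume "\<not> ?thesis"
    then have "N l k \<subseteq> N i j - {a}" using that unfolding N_def by auto
    then have "card (N l k) \<le> card (N i j - {a})" using finN by (intro card_mono) auto
    also have "\<dots> < card (N i j)" using card_Diff1_less[OF finN that(3)] .
    finally show False using min[OF that(1,2)] by simp
  qed
  have full: "D' a k \<noteq> 0" if a: "a \<in> N i j" and k: "k \<in> J" for a k
  proof
    assume z: "D' a k = 0"
    obtain b where b: "b \<in> N i k" "D' b j = 0" using escape[OF ij(1) k a z, of j] by blast
    obtain c where c: "c \<in> N j k" "D' c i = 0" using escape[OF ij(2) k a z, of i] unfolding N_def by blast
    have C: "i \<in> C" "j \<in> C" "k \<in> C" using ij k J(1) by auto
    note G = gram_sign[OF D] and G' = gram_sign[OF D']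
    have "(D' a i * D' a j) * (D' b i * D' b k) * (D' c j * D' c k) = -1"
      by (rule unimodular3_3[OF D'(1)]) (use a b c z C in \<open>auto simp: N_def\<close>)
    moreover have "D' a i * D' a j = D s i * D s j"
      using G[OF s(1) C(1,2)] G'[of a i j] s(2) ij k a C g unfolding N_def by auto
    moreover have "D' b i * D' b k = D s i * D s k"
      using G[OF s(1) C(1,3)] G'[of b i k] s(2) ij k b C g unfolding N_def by auto
    moreover have "D' c j * D' c k = D s j * D s k"
      using G[OF s(1) C(2,3)] G'[of c j k] s(2) ij k c C g unfolding N_def by auto
    ultimately show False
      using unimodular3_entry[OF D(1) s(1) C(1)] unimodular3_entry[OF D(1) s(1) C(2)]
        unimodular3_entry[OF D(1) s(1) C(3)] s(2)[OF ij(1)] s(2)[OF ij(2)] s(2)[OF k] by auto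
  qed
  have ijC: "i \<in> C" "j \<in> C" using ij J(1) by auto
  have "card {r\<in>R. \<forall>i\<in>J. D r i \<noteq> 0} \<le> card {r\<in>R. D r i \<noteq> 0 \<and> D r j \<noteq> 0}"
    using D(2) ij by (intro card_mono) auto
  also have "\<dots> = card (N i j)" unfolding cN[OF ijC] abs_gram[OF D ijC] by (rule nat_int[symmetric])
  also have "\<dots> \<le> card {r\<in>R'. \<forall>i\<in>J. D' r i \<noteq> 0}"
  proof (rule card_mono)
    show "finite {r\<in>R'. \<forall>i\<in>J. D' r i \<noteq> 0}" using D'(2) by simp
    have "N i j \<subseteq> R'" unfolding N_def by blast
    then show "N i j \<subseteq> {r\<in>R'. \<forall>i\<in>J. D' r i \<noteq> 0}" using full by blast
  qed
  finally show ?thesis .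
qed

text \<open>
  Downward induction on \<open>J\<close>: the sets of rows with a given support partition those whose
  support contains \<open>J\<close>.
\<close>

lemma card_support_from_supersets:
  fixes S :: "'r \<Rightarrow> 'c set" and S' :: "'p \<Rightarrow> 'c set"
  assumes fin: "finite C" "finite R" "finite R'"
    and S: "\<And>r. r \<in> R \<Longrightarrow> S r \<subseteq> C" "\<And>r. r \<in> R' \<Longrightarrow> S' r \<subseteq> C"
    and N: "\<And>J. J \<subseteq> C \<Longrightarrow> J \<noteq> {} \<Longrightarrow> card {r\<in>R. J \<subseteq> S r} = card {r\<in>R'. J \<subseteq> S' r}"
    and J: "J \<subseteq> C" "J \<noteq> {}"
  shows "card {r\<in>R. S r = J} = card {r\<in>R'. S' r = J}"
  using J
proof (induction "card (C - J)" arbitrary: J rule: less_induct)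
  case less
  let ?K = "{K. J \<subset> K \<and> K \<subseteq> C}"
  have finK: "finite ?K" using fin(1) by (rule_tac finite_subset[of _ "Pow C"]) auto
  have split: "card {r\<in>Q. J \<subseteq> U r} = card {r\<in>Q. U r = J} + (\<Sum>K\<in>?K. card {r\<in>Q. U r = K})"
    if Q: "finite Q" "\<And>r. r \<in> Q \<Longrightarrow> U r \<subseteq> C" for Q and U :: "'q \<Rightarrow> 'c set"
  proof -
    have "{r\<in>Q. J \<subseteq> U r} = {r\<in>Q. U r = J} \<union> (\<Union>K\<in>?K. {r\<in>Q. U r = K})" using Q(2) less(2) by auto
    also have "card \<dots> = card {r\<in>Q. U r = J} + card (\<Union>K\<in>?K. {r\<in>Q. U r = K})"
      using Q(1) finK by (intro card_Un_disjoint) auto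
    also have "card (\<Union>K\<in>?K. {r\<in>Q. U r = K}) = (\<Sum>K\<in>?K. card {r\<in>Q. U r = K})"
      using Q(1) finK by (intro card_UN_disjoint) auto
    finally show ?thesis .
  qed
  have "(\<Sum>K\<in>?K. card {r\<in>R. S r = K}) = (\<Sum>K\<in>?K. card {r\<in>R'. S' r = K})"
  proof (rule sum.cong[OF refl])
    fix K assume K: "K \<in> ?K"
    then have "card (C - K) < card (C - J)" using fin(1) by (intro psubset_card_mono) auto
    then show "card {r\<in>R. S r = K} = card {r\<in>R'. S' r = K}" using less(1) K by auto
  qed
  then show ?case using split[OF fin(2) S(1)] split[OF fin(3) S(2)] N[OF less(2,3)] by simp
qed

lemma bij_from_fibres:
  fixes S :: "'r \<Rightarrow> 'k" and S' :: "'p \<Rightarrow> 'k"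
  assumes fin: "finite R" "finite R'"
    and fib: "\<And>J. card {r\<in>R. S r = J} = card {r\<in>R'. S' r = J}"
  obtains \<rho> where "bij_betw \<rho> R R'" "\<And>r. r \<in> R \<Longrightarrow> S' (\<rho> r) = S r"
proof -
  have "\<exists>f. bij_betw f {r\<in>R. S r = J} {r\<in>R'. S' r = J}" for J
    using finite_same_card_bij[OF _ _ fib[of J]] fin by simp
  then obtain f where f: "\<And>J. bij_betw (f J) {r\<in>R. S r = J} {r\<in>R'. S' r = J}" by metis
  define \<rho> where "\<rho> r = f (S r) r" for r
  have 1: "\<rho> r \<in> R' \<and> S' (\<rho> r) = S r" if "r \<in> R" for r
    using bij_betwE[OF f[of "S r"]] that unfolding \<rho>_def by auto
  have "bij_betw \<rho> R R'"
  proof (rule bij_betw_imageI)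
    show "inj_on \<rho> R"
    proof (rule inj_onI)
      fix x y assume xy: "x \<in> R" "y \<in> R" "\<rho> x = \<rho> y"
      then have "S x = S y" using 1 by metis
      then show "x = y" using xy bij_betw_imp_inj_on[OF f[of "S x"]] unfolding \<rho>_def inj_on_def by auto
    qed
    show "\<rho> ` R = R'"
    proof (intro equalityI subsetI)
      fix y assume "y \<in> \<rho> ` R" then show "y \<in> R'" using 1 by auto
    next
      fix y assume "y \<in> R'"
      then have "y \<in> f (S' y) ` {r\<in>R. S r = S' y}" using bij_betw_imp_surj_on[OF f[of "S' y"]] by auto
      then obtain x where x: "x \<in> R" "S x = S' y" "y = f (S' y) x" by blast
      then have "y = \<rho> x" unfolding \<rho>_def by simp
      then show "y \<in> \<rho> ` R" using x(1) by blast
    qed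
  qed
  then show ?thesis using 1 that by blast
qed

text \<open>
  The counts of rows with a given support agree, so the rows can be matched with equal supports.
  Within the support the products of two entries are the signs of the Gram entries, hence
  matched rows agree up to a global sign. Zero rows are invisible in the Gram matrix and have to be
  excluded.
\<close>

lemma rows_from_gram:
  assumes D: "unimodular3 R C D" "finite R" and D': "unimodular3 R' C D'" "finite R'"
    and finC: "finite C"
    and nz: "\<And>r. r \<in> R \<Longrightarrow> \<exists>c\<in>C. D r c \<noteq> 0" "\<And>r. r \<in> R' \<Longrightarrow> \<exists>c\<in>C. D' r c \<noteq> 0"
    and g: "\<And>i j. i \<in> C \<Longrightarrow> j \<in> C \<Longrightarrow> gram R D i j = gram R' D' i j"
  shows "\<exists>\<rho> \<eta>. bij_betw \<rho> R R' \<and> (\<forall>r. \<eta> r \<in> {-1, 1}) \<and>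
    (\<forall>r\<in>R. \<forall>c\<in>C. D' (\<rho> r) c = \<eta> r * D r c)"
proof -
  define S where "S r = {c\<in>C. D r c \<noteq> 0}" for r
  define S' where "S' r = {c\<in>C. D' r c \<noteq> 0}" for r
  have N: "card {r\<in>R. J \<subseteq> S r} = card {r\<in>R'. J \<subseteq> S' r}" if J: "J \<subseteq> C" "J \<noteq> {}" for J
  proof -
    have finJ: "finite J" using J finC finite_subset by blast
    have "{r\<in>R. J \<subseteq> S r} = {r\<in>R. \<forall>i\<in>J. D r i \<noteq> 0}" "{r\<in>R'. J \<subseteq> S' r} = {r\<in>R'. \<forall>i\<in>J. D' r i \<noteq> 0}"
      unfolding S_def S'_def using J(1) by auto
    then show ?thesis
      using count_superset_le[OF D D' g J finJ] count_superset_le[OF D' D g[symmetric] J finJ] by simp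
  qed
  have fib: "card {r\<in>R. S r = J} = card {r\<in>R'. S' r = J}" for J
  proof (cases "J \<subseteq> C \<and> J \<noteq> {}")
    case True
    then show ?thesis
      using card_support_from_supersets[OF finC D(2) D'(2), of S S' J] N unfolding S_def S'_def by blast
  next
    case False
    then have "{r\<in>R. S r = J} = {}" "{r\<in>R'. S' r = J} = {}"
      using nz unfolding S_def S'_def by blast+
    then show ?thesis by (simp only: card.empty)
  qed
  obtain \<rho> where \<rho>: "bij_betw \<rho> R R'" "\<And>r. r \<in> R \<Longrightarrow> S' (\<rho> r) = S r"
    using bij_from_fibres[of R R' S S'] fib D(2) D'(2) by blast
  define p where "p r = (SOME c. c \<in> S r)" for r
  define \<eta> where "\<eta> r = (if r \<in> R then D r (p r) * D' (\<rho> r) (p r) else 1)" for r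
  have p: "p r \<in> S r" if "r \<in> R" for r
    unfolding p_def using nz(1)[OF that] unfolding S_def by (metis (mono_tags, lifting) mem_Collect_eq someI)
  have R': "\<rho> r \<in> R'" if "r \<in> R" for r using \<rho>(1) that by (rule bij_betw_apply)
  have \<eta>: "\<eta> r \<in> {-1, 1}" for r
  proof (cases "r \<in> R")
    case True
    then have "p r \<in> S r" "p r \<in> S' (\<rho> r)" using p \<rho>(2) by auto
    then show ?thesis
      using unimodular3_entry[OF D(1) True, of "p r"] unimodular3_entry[OF D'(1) R'[OF True], of "p r"]
      unfolding S_def S'_def \<eta>_def by auto
  qed (simp add: \<eta>_def)
  have "D' (\<rho> r) c = \<eta> r * D r c" if r: "r \<in> R" and c: "c \<in> C" for r c
  proof (cases "c \<in> S r")
    case True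
    then have c': "c \<in> S' (\<rho> r)" "p r \<in> S r" "p r \<in> S' (\<rho> r)" using p[OF r] \<rho>(2)[OF r] by auto
    have "D r (p r) * D r c = D' (\<rho> r) (p r) * D' (\<rho> r) c"
      using gram_sign[OF D r, of "p r" c] gram_sign[OF D' R'[OF r], of "p r" c] g[of "p r" c] c' True
      unfolding S_def S'_def by auto
    then show ?thesis
      using True c' r unimodular3_entry[OF D(1) r, of "p r"] unimodular3_entry[OF D'(1) R'[OF r], of "p r"]
        unimodular3_entry[OF D(1) r, of c] unimodular3_entry[OF D'(1) R'[OF r], of c]
      unfolding S_def S'_def \<eta>_def by auto
  next
    case False
    then have "c \<notin> S' (\<rho> r)" using \<rho>(2)[OF r] by auto
    then show ?thesis using False c unfolding S_def S'_def by auto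
  qed
  then show ?thesis using \<rho>(1) \<eta> by blast
qed

text \<open>
  Relabelling and signing the columns of \<open>D'\<close> reduces an equivalence of Gram matrices to equality.
\<close>

lemma signed_equiv_iff_gram_equiv:
  assumes D: "unimodular3 R C D" "finite R" and D': "unimodular3 R' C' D'" "finite R'"
    and finC: "finite C"
    and nz: "\<And>r. r \<in> R \<Longrightarrow> \<exists>c\<in>C. D r c \<noteq> 0" "\<And>r. r \<in> R' \<Longrightarrow> \<exists>c\<in>C'. D' r c \<noteq> 0"
  shows "forms_equiv C (gram R D) C' (gram R' D') \<longleftrightarrow> signed_equiv R C D R' C' D'"
proof
  assume "forms_equiv C (gram R D) C' (gram R' D')"
  then obtain \<sigma> \<epsilon> where \<sigma>: "bij_betw \<sigma> C C'" and \<epsilon>: "\<And>c. \<epsilon> c \<in> {-1, 1::int}"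
    and eq: "\<And>i j. i \<in> C \<Longrightarrow> j \<in> C \<Longrightarrow> gram R' D' (\<sigma> i) (\<sigma> j) = \<epsilon> i * \<epsilon> j * gram R D i j"
    unfolding forms_equiv_def by blast
  define D1 where "D1 r c = \<epsilon> c * D' r (\<sigma> c)" for r c
  have \<epsilon>2: "\<epsilon> c * \<epsilon> c = 1" for c using \<epsilon>[of c] by auto
  have \<sigma>C: "\<sigma> c \<in> C'" if "c \<in> C" for c using \<sigma> that by (rule bij_betw_apply)
  have \<epsilon>0: "\<epsilon> c \<noteq> 0" for c using \<epsilon>[of c] by auto
  have D1: "unimodular3 R' C D1"
    unfolding unimodular3_def
  proof (intro conjI ballI impI; (elim conjE)?)
    fix r c assume "r \<in> R'" "c \<in> C"
    then show "D1 r c \<in> {-1, 0, 1}" using unimodular3_entry[OF D'(1), of r "\<sigma> c"] \<sigma>C \<epsilon>[of c]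
      unfolding D1_def by auto
  next
    fix r s i j assume "r \<in> R'" "s \<in> R'" "i \<in> C" "j \<in> C"
      "D1 r i \<noteq> 0" "D1 r j \<noteq> 0" "D1 s i \<noteq> 0" "D1 s j \<noteq> 0"
    then have "D' r (\<sigma> i) * D' r (\<sigma> j) = D' s (\<sigma> i) * D' s (\<sigma> j)"
      using unimodular3_2[OF D'(1), of r s "\<sigma> i" "\<sigma> j"] \<sigma>C unfolding D1_def by auto
    then show "D1 r i * D1 r j = D1 s i * D1 s j"
      unfolding D1_def by (metis mult.assoc mult.left_commute)
  next
    fix r s t i j k assume "r \<in> R'" "s \<in> R'" "t \<in> R'" "i \<in> C" "j \<in> C" "k \<in> C"
      "D1 r i \<noteq> 0" "D1 r j \<noteq> 0" "D1 r k = 0" "D1 s i \<noteq> 0" "D1 s j = 0" "D1 s k \<noteq> 0"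
      "D1 t i = 0" "D1 t j \<noteq> 0" "D1 t k \<noteq> 0"
    then have "(D' r (\<sigma> i) * D' r (\<sigma> j)) * (D' s (\<sigma> i) * D' s (\<sigma> k)) * (D' t (\<sigma> j) * D' t (\<sigma> k)) = -1"
      using \<epsilon>0 \<sigma>C by (intro unimodular3_3[OF D'(1)]) (auto simp: D1_def)
    moreover have "(D1 r i * D1 r j) * (D1 s i * D1 s k) * (D1 t j * D1 t k) =
      (\<epsilon> i * \<epsilon> i) * (\<epsilon> j * \<epsilon> j) * (\<epsilon> k * \<epsilon> k) *
      ((D' r (\<sigma> i) * D' r (\<sigma> j)) * (D' s (\<sigma> i) * D' s (\<sigma> k)) * (D' t (\<sigma> j) * D' t (\<sigma> k)))"
      unfolding D1_def by (simp only: ac_simps)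
    ultimately show "(D1 r i * D1 r j) * (D1 s i * D1 s k) * (D1 t j * D1 t k) = -1"
      by (simp add: \<epsilon>2)
  qed
  have nz1: "\<exists>c\<in>C. D1 r c \<noteq> 0" if "r \<in> R'" for r
    using nz(2)[OF that] \<sigma> \<epsilon>0 unfolding D1_def bij_betw_def by auto
  have g: "gram R D i j = gram R' D1 i j" if "i \<in> C" "j \<in> C" for i j
  proof -
    have "gram R' D1 i j = \<epsilon> i * \<epsilon> j * gram R' D' (\<sigma> i) (\<sigma> j)"
      unfolding gram_def D1_def sum_distrib_left by (rule sum.cong) auto
    also have "\<dots> = (\<epsilon> i * \<epsilon> i) * (\<epsilon> j * \<epsilon> j) * gram R D i j" using eq[OF that] by simp
    finally show ?thesis by (simp add: \<epsilon>2)
  qed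
  obtain \<rho> \<eta> where \<rho>: "bij_betw \<rho> R R'" and \<eta>: "\<forall>r. \<eta> r \<in> {-1, 1::int}"
    and e: "\<forall>r\<in>R. \<forall>c\<in>C. D1 (\<rho> r) c = \<eta> r * D r c"
    using rows_from_gram[OF D D1 D'(2) finC nz(1) nz1 g] by blast
  have "D' (\<rho> r) (\<sigma> c) = \<eta> r * \<epsilon> c * D r c" if "r \<in> R" "c \<in> C" for r c
  proof -
    have "D' (\<rho> r) (\<sigma> c) = \<epsilon> c * D1 (\<rho> r) c"
      unfolding D1_def using \<epsilon>2[of c] by (simp flip: mult.assoc)
    then show ?thesis using e that by simp
  qed
  then show "signed_equiv R C D R' C' D'" unfolding signed_equiv_def using \<rho> \<sigma> \<eta> \<epsilon> by blast
next
  assume "signed_equiv R C D R' C' D'"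
  then obtain \<rho> \<sigma> \<eta> \<epsilon> where \<rho>: "bij_betw \<rho> R R'" and \<sigma>: "bij_betw \<sigma> C C'"
    and \<eta>: "\<And>r. \<eta> r \<in> {-1, 1::int}" and \<epsilon>: "\<And>c. \<epsilon> c \<in> {-1, 1::int}"
    and e: "\<And>r c. r \<in> R \<Longrightarrow> c \<in> C \<Longrightarrow> D' (\<rho> r) (\<sigma> c) = \<eta> r * \<epsilon> c * D r c"
    unfolding signed_equiv_def by blast
  have \<eta>2: "\<eta> r * \<eta> r = 1" for r using \<eta>[of r] by auto
  have "gram R' D' (\<sigma> i) (\<sigma> j) = \<epsilon> i * \<epsilon> j * gram R D i j" if "i \<in> C" "j \<in> C" for i j
  proof -
    have "gram R' D' (\<sigma> i) (\<sigma> j) = (\<Sum>r\<in>R. D' (\<rho> r) (\<sigma> i) * D' (\<rho> r) (\<sigma> j))"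
      unfolding gram_def by (rule sum.reindex_bij_betw[OF \<rho>, symmetric])
    also have "\<dots> = (\<Sum>r\<in>R. \<epsilon> i * \<epsilon> j * (D r i * D r j))"
    proof (rule sum.cong[OF refl])
      fix r assume r: "r \<in> R"
      have "D' (\<rho> r) (\<sigma> i) * D' (\<rho> r) (\<sigma> j) = (\<eta> r * \<eta> r) * (\<epsilon> i * \<epsilon> j * (D r i * D r j))"
        using e[OF r] that by simp
      then show "D' (\<rho> r) (\<sigma> i) * D' (\<rho> r) (\<sigma> j) = \<epsilon> i * \<epsilon> j * (D r i * D r j)"
        by (simp add: \<eta>2)
    qed
    finally show ?thesis unfolding gram_def sum_distrib_left .
  qed
  then show "forms_equiv C (gram R D) C' (gram R' D')" unfolding forms_equiv_def using \<sigma> \<epsilon> by blast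
qed

lemma signed_equiv_transposeI:
  assumes "signed_equiv R C D R' C' D'"
  shows "signed_equiv C R (\<lambda>c r. D r c) C' R' (\<lambda>c r. D' r c)"
proof -
  obtain \<rho> \<sigma> \<eta> \<epsilon> where *: "bij_betw \<rho> R R'" "bij_betw \<sigma> C C'"
    "\<forall>r. \<eta> r \<in> {-1, 1::int}" "\<forall>c. \<epsilon> c \<in> {-1, 1::int}"
    "\<forall>r\<in>R. \<forall>c\<in>C. D' (\<rho> r) (\<sigma> c) = \<eta> r * \<epsilon> c * D r c"
    using assms unfolding signed_equiv_def by blast
  then have "\<forall>c\<in>C. \<forall>r\<in>R. D' (\<rho> r) (\<sigma> c) = \<epsilon> c * \<eta> r * D r c" by simp
  with * show ?thesis unfolding signed_equiv_def by blast
qed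

lemma signed_equiv_transpose:
  "signed_equiv C R (\<lambda>c r. D r c) C' R' (\<lambda>c r. D' r c) \<longleftrightarrow> signed_equiv R C D R' C' D'"
  using signed_equiv_transposeI[of C R "\<lambda>c r. D r c" C' R' "\<lambda>c r. D' r c"]
    signed_equiv_transposeI[of R C D R' C' D'] by blast

section \<open>Uniqueness of signings\<close>

text \<open>
  Camion's theorem that the support determines the signs up to scaling of rows and columns.

  Two columns with a common nonzero row are adjacent; the edge carries the sign \<open>\<tau>\<close> by which the products
  of the two entries differ in \<open>D\<close> and \<open>D'\<close>, which is independent of the row. It has to be shown that
  \<open>\<tau>\<close> is a coboundary, that is, that in the double cover with edge relation \<open>X\<close> no vertex is
  connected to its opposite \<open>flip\<close>. A shortest walk from a vertex to its opposite projects to a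
  chordless cycle, because a chord or a repeated vertex would split it into two closed walks, one of which
  is again unbalanced. If some row is nonzero on the whole cycle, this row exhibits \<open>\<tau>\<close> as a
  coboundary there. Otherwise no row meets the cycle in more than two columns, and the
  equitable signings of the columns of the cycle, one for \<open>D\<close> and one for \<open>D'\<close>, do so.
\<close>

lemma signing_unique:
  fixes D D' :: "'r \<Rightarrow> 'c \<Rightarrow> int"
  assumes E: "equitable R C D" and E': "equitable R C D'"
    and supp: "\<And>r c. r \<in> R \<Longrightarrow> c \<in> C \<Longrightarrow> D r c = 0 \<longleftrightarrow> D' r c = 0"
  obtains \<epsilon> where "\<And>c. \<epsilon> c \<in> {-1, 1::int}"
    "\<And>r i j. r \<in> R \<Longrightarrow> i \<in> C \<Longrightarrow> j \<in> C \<Longrightarrow> D r i \<noteq> 0 \<Longrightarrow> D r j \<noteq> 0 \<Longrightarrow>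
      D' r i * D' r j = \<epsilon> i * \<epsilon> j * (D r i * D r j)"
proof -
  define \<tau> where "\<tau> r i j = D r i * D r j * (D' r i * D' r j)" for r i j
  note m = equitable_unimodular3[OF E] and m' = equitable_unimodular3[OF E']
  have pm: "D r c \<in> {-1, 1}" "D' r c \<in> {-1, 1}" if "r \<in> R" "c \<in> C" "D r c \<noteq> 0" for r c
    using unimodular3_entry[OF m that(1,2)] unimodular3_entry[OF m' that(1,2)] supp[OF that(1,2)] that(3) by auto
  have \<tau>pm: "\<tau> r i j \<in> {-1, 1}" if "r \<in> R" "i \<in> C" "j \<in> C" "D r i \<noteq> 0" "D r j \<noteq> 0" for r i j
    unfolding \<tau>_def using pm[OF that(1,2,4)] pm[OF that(1,3,5)] by auto
  have \<tau>eq: "\<tau> r i j = \<tau> s i j"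
    if "r \<in> R" "s \<in> R" "i \<in> C" "j \<in> C" "D r i \<noteq> 0" "D r j \<noteq> 0" "D s i \<noteq> 0" "D s j \<noteq> 0" for r s i j
    unfolding \<tau>_def using unimodular3_2[OF m that(1-4)] unimodular3_2[OF m' that(1-4)] supp that by metis
  have \<tau>sym: "\<tau> r i j = \<tau> r j i" for r i j unfolding \<tau>_def by simp
  define X where "X = {((i, s), (j, s')) | i j s s'. i \<in> C \<and> j \<in> C \<and> i \<noteq> j \<and> s \<in> {-1, 1::int} \<and>
    (\<exists>r\<in>R. D r i \<noteq> 0 \<and> D r j \<noteq> 0 \<and> s' = s * \<tau> r i j)}"
  have XI: "((i, s), (j, s * \<tau> r i j)) \<in> X"
    if "r \<in> R" "i \<in> C" "j \<in> C" "i \<noteq> j" "D r i \<noteq> 0" "D r j \<noteq> 0" "s \<in> {-1, 1}" for i j s r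
    unfolding X_def using that by blast
  have XE: "\<exists>r\<in>R. fst x \<in> C \<and> fst y \<in> C \<and> fst x \<noteq> fst y \<and> D r (fst x) \<noteq> 0 \<and> D r (fst y) \<noteq> 0 \<and>
      snd y = snd x * \<tau> r (fst x) (fst y) \<and> snd x \<in> {-1, 1} \<and> snd y \<in> {-1, 1}" if "(x, y) \<in> X" for x y
    using that \<tau>pm unfolding X_def by fastforce
  have Xsym: "sym X"
  proof (rule symI)
    fix x y assume "(x, y) \<in> X"
    then obtain r where r: "r \<in> R" "fst x \<in> C" "fst y \<in> C" "fst x \<noteq> fst y" "D r (fst x) \<noteq> 0" "D r (fst y) \<noteq> 0"
      "snd y = snd x * \<tau> r (fst x) (fst y)" "snd x \<in> {-1, 1}" "snd y \<in> {-1, 1}" using XE by blast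
    have "snd x = snd y * \<tau> r (fst y) (fst x)"
      using r(7) \<tau>pm[OF r(1,2,3,5,6)] by (auto simp: \<tau>sym[of r "fst y"])
    then show "(y, x) \<in> X" using XI[OF r(1) r(3) r(2) r(4)[symmetric] r(6,5,9)] by (metis prod.collapse)
  qed
  define flip where "flip x = (fst x, - snd x)" for x :: "'c \<times> int"
  have no_bad: "(x, flip x) \<notin> X ^^ n" if "snd x \<noteq> 0" for x n
  proof
    assume "(x, flip x) \<in> X ^^ n"
    define bad where "bad n \<longleftrightarrow> (\<exists>x. snd x \<noteq> 0 \<and> (x, flip x) \<in> X ^^ n)" for n
    have "\<exists>n. bad n" using that \<open>(x, flip x) \<in> X ^^ n\<close> unfolding bad_def by blast
    then obtain n where "bad n" and least: "\<And>k. k < n \<Longrightarrow> \<not> bad k"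
      using exists_least_iff[of bad] by blast
    obtain x where x: "snd x \<noteq> 0" "(x, flip x) \<in> X ^^ n" using \<open>bad n\<close> unfolding bad_def by blast
    then obtain f where f: "f 0 = x" "f n = flip x" "\<And>i. i < n \<Longrightarrow> (f i, f (Suc i)) \<in> X"
      using relpow_fun_conv[of x "flip x" n X] by blast
    define v where "v i = fst (f i)" for i
    define s where "s i = snd (f i)" for i
    have fvs: "f i = (v i, s i)" for i unfolding v_def s_def by simp
    have n0: "n \<noteq> 0"
    proof
      assume "n = 0" then have "x = flip x" using f by simp
      then show False using x(1) unfolding flip_def by (cases x) auto
    qed
    have step: "\<exists>r\<in>R. v i \<in> C \<and> v (Suc i) \<in> C \<and> v i \<noteq> v (Suc i) \<and> D r (v i) \<noteq> 0 \<and> D r (v (Suc i)) \<noteq> 0 \<and>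
      s (Suc i) = s i * \<tau> r (v i) (v (Suc i)) \<and> s i \<in> {-1, 1} \<and> s (Suc i) \<in> {-1, 1}" if "i < n" for i
      using XE[OF f(3)[OF that]] unfolding v_def s_def .
    have vn: "v n = v 0" and sn: "s n = - s 0" using f(1,2) unfolding v_def s_def flip_def by auto
    have vs: "v i \<in> C \<and> s i \<in> {-1, 1}" if "i \<le> n" for i
    proof (cases "i < n")
      case True
      then show ?thesis using step by blast
    next
      case False
      then have "i = Suc (n - 1)" "n - 1 < n" using that n0 by auto
      then show ?thesis using step[of "n - 1"] by metis
    qed
    have vC: "v i \<in> C" if "i \<le> n" for i using vs[OF that] by (rule conjunct1)
    have spm: "s i \<in> {-1, 1}" if "i \<le> n" for i using vs[OF that] by (rule conjunct2)
    have walk: "(f a, f b) \<in> X ^^ (b - a)" if "a \<le> b" "b \<le> n" for a b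
    proof -
      have "\<exists>g. g 0 = f a \<and> g (b - a) = f b \<and> (\<forall>i<b - a. (g i, g (Suc i)) \<in> X)"
        by (rule exI[of _ "\<lambda>i. f (a + i)"]) (use that f(3) in auto)
      then show ?thesis using relpow_fun_conv[of "f a" "f b" "b - a" X] by blast
    qed
    have no_closed: "(f a, flip (f a)) \<notin> X ^^ k" if "k < n" "a \<le> n" for a k
    proof
      assume "(f a, flip (f a)) \<in> X ^^ k"
      moreover have "snd (f a) \<noteq> 0" using spm[OF that(2)] unfolding s_def by auto
      ultimately have "bad k" unfolding bad_def by blast
      then show False using least[OF that(1)] by blast
    qed
    have no_short: "(f 0, f n) \<notin> X ^^ k" if "k < n" for k
      using no_closed[OF that, of 0] f(1,2) by simp
    have same: "f b = f a \<or> f b = flip (f a)" if "v a = v b" "a \<le> n" "b \<le> n" for a b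
      using that spm[OF that(2)] spm[OF that(3)] unfolding fvs flip_def by auto
    have dist: "v a \<noteq> v b" if ab: "a < b" "b \<le> n" "b - a < n" for a b
    proof
      assume "v a = v b"
      then consider "f b = f a" | "f b = flip (f a)" using same ab by fastforce
      then show False
      proof cases
        case 1
        have "(f 0, f n) \<in> X ^^ (a + (n - b))"
          unfolding relpow_add using walk[of 0 a] walk[of b n] ab 1 by auto
        moreover have "a + (n - b) < n" using ab by linarith
        ultimately show False using no_short by blast
      next
        case 2
        then show False using walk[of a b] ab no_closed[of "b - a" a] by simp
      qed
    qed
    have chordless: "b = Suc a \<or> a = 0 \<and> b = n - 1"
      if ab: "a < b" "b < n" and r: "r \<in> R" "D r (v a) \<noteq> 0" "D r (v b) \<noteq> 0" for a b r
    proof (rule ccontr)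
      assume nn: "\<not> (b = Suc a \<or> a = 0 \<and> b = n - 1)"
      have ne: "v a \<noteq> v b" using dist ab by simp
      have C: "v a \<in> C" "v b \<in> C" using vC ab by auto
      have e1: "(f a, (v b, s a * \<tau> r (v a) (v b))) \<in> X"
        unfolding fvs using XI[OF r(1) C ne r(2,3)] spm ab by auto
      have e2: "(f b, (v a, s b * \<tau> r (v b) (v a))) \<in> X"
        unfolding fvs using XI[OF r(1) C(2,1) ne[symmetric] r(3,2)] spm ab by auto
      show False
      proof (cases "s b = s a * \<tau> r (v a) (v b)")
        case True
        then have "(f a, f b) \<in> X" using e1 unfolding fvs[of b] by simp
        then have "(f 0, f b) \<in> X ^^ Suc a" using walk[of 0 a] ab by auto
        moreover have "(f b, f n) \<in> X ^^ (n - b)" using walk[of b n] ab by simp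
        ultimately have "(f 0, f n) \<in> X ^^ (Suc a + (n - b))"
          unfolding relpow_add by (rule relcompI)
        moreover have "Suc a + (n - b) < n" using ab nn by linarith
        ultimately show False using no_short by blast
      next
        case False
        have "s b * \<tau> r (v b) (v a) = - s a"
          using False spm[of a] spm[of b] ab \<tau>pm[OF r(1) C r(2,3)] by (auto simp: \<tau>sym[of r "v b"])
        then have "(f b, flip (f a)) \<in> X" using e2 unfolding flip_def fvs by simp
        then have "(f a, flip (f a)) \<in> X ^^ Suc (b - a)" using walk[of a b] ab by auto
        moreover have "Suc (b - a) < n" "a \<le> n" using ab nn by linarith+
        ultimately show False using no_closed by blast
      qed
    qed
    have n3: "n \<ge> 3"
    proof -
      have "n \<noteq> 1" using step[of 0] vn by auto
      moreover have "n \<noteq> 2"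
      proof
        assume n2: "n = 2"
        obtain r where r: "r \<in> R" "v 0 \<in> C" "v 1 \<in> C" "D r (v 0) \<noteq> 0" "D r (v 1) \<noteq> 0" "s 1 = s 0 * \<tau> r (v 0) (v 1)"
          using step[of 0] n2 by auto
        obtain r' where r': "r' \<in> R" "D r' (v 0) \<noteq> 0" "D r' (v 1) \<noteq> 0" "s 2 = s 1 * \<tau> r' (v 0) (v 1)"
          using step[of 1] n2 vn by (auto simp: \<tau>sym numeral_2_eq_2)
        have "\<tau> r (v 0) (v 1) = \<tau> r' (v 0) (v 1)" using \<tau>eq r r' by blast
        then have "s 2 = s 0" using r r' \<tau>pm[OF r(1-5)] by auto
        then show False using sn spm[of 0] n2 by auto
      qed
      ultimately show ?thesis using n0 by linarith
    qed
    define J where "J = v ` {..<n}"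
    have J: "J \<subseteq> C" "finite J" unfolding J_def using vC by auto
    have vJ: "v i \<in> J" if "i \<le> n" for i
      using that vn n0 unfolding J_def by (cases "i = n") (auto intro: image_eqI[of _ _ 0])
    have "\<exists>\<eta>. (\<forall>c\<in>J. \<eta> c \<in> {-1, 1::int}) \<and> (\<forall>i<n. s (Suc i) = s i * (\<eta> (v i) * \<eta> (v (Suc i))))"
    proof (cases "\<exists>r\<in>R. \<forall>c\<in>J. D r c \<noteq> 0")
      case True
      then obtain r where r: "r \<in> R" "\<And>c. c \<in> J \<Longrightarrow> D r c \<noteq> 0" by blast
      have "s (Suc i) = s i * (D r (v i) * D' r (v i) * (D r (v (Suc i)) * D' r (v (Suc i))))" if i: "i < n" for i
      proof -
        obtain r' where r': "r' \<in> R" "v i \<in> C" "v (Suc i) \<in> C" "D r' (v i) \<noteq> 0" "D r' (v (Suc i)) \<noteq> 0"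
          "s (Suc i) = s i * \<tau> r' (v i) (v (Suc i))" using step[OF i] by blast
        have "\<tau> r' (v i) (v (Suc i)) = \<tau> r (v i) (v (Suc i))"
          using \<tau>eq[OF r'(1) r(1) r'(2,3,4,5)] r(2) vJ i by auto
        then show ?thesis using r'(6) unfolding \<tau>_def by (simp add: ac_simps)
      qed
      moreover have "D r c * D' r c \<in> {-1, 1}" if "c \<in> J" for c
      proof -
        have "c \<in> C" using that J(1) by blast
        then show ?thesis using pm[OF r(1) _ r(2)[OF that]] by auto
      qed
      ultimately show ?thesis by (intro exI[of _ "\<lambda>c. D r c * D' r c"]) blast
    next
      case False
      obtain e where e: "\<forall>j. e j \<in> {-1, 1::int}" "\<forall>r\<in>R. (\<Sum>j\<in>J. e j * D r j) \<in> {-1, 0, 1}"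
        using E J(1) unfolding equitable_def by blast
      obtain e' where e': "\<forall>j. e' j \<in> {-1, 1::int}" "\<forall>r\<in>R. (\<Sum>j\<in>J. e' j * D' r j) \<in> {-1, 0, 1}"
        using E' J(1) unfolding equitable_def by blast
      have "s (Suc i) = s i * (e (v i) * e' (v i) * (e (v (Suc i)) * e' (v (Suc i))))" if i: "i < n" for i
      proof -
        obtain r where r: "r \<in> R" "v i \<in> C" "v (Suc i) \<in> C" "v i \<noteq> v (Suc i)" "D r (v i) \<noteq> 0" "D r (v (Suc i)) \<noteq> 0"
          "s (Suc i) = s i * \<tau> r (v i) (v (Suc i))" using step[OF i] by blast
        \<comment> \<open>the walk closes up at \<open>n\<close>, but \<open>chordless\<close> speaks of indices below \<open>n\<close>\<close>
        define i' where "i' = (if Suc i = n then 0 else Suc i)"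
        have i': "i' < n" "v i' = v (Suc i)" "i' \<noteq> i" unfolding i'_def using i vn n3 by auto
        have only: "D r c = 0" if c: "c \<in> J" "c \<noteq> v i" "c \<noteq> v (Suc i)" for c
        proof (rule ccontr)
          assume nz: "D r c \<noteq> 0"
          obtain k where k: "k < n" "c = v k" using c unfolding J_def by blast
          have ki: "k \<noteq> i" "k \<noteq> i'" using k c i' by auto
          have near: "b = Suc a \<or> a = Suc b \<or> a = 0 \<and> b = n - 1 \<or> b = 0 \<and> a = n - 1"
            if "a < n" "b < n" "a \<noteq> b" "a \<in> {k, i, i'}" "b \<in> {k, i, i'}" for a b
          proof -
            have "D r (v a) \<noteq> 0" "D r (v b) \<noteq> 0" using that nz r k i' by auto
            then show ?thesis
              using chordless[of a b r] chordless[of b a r] r(1) that by (cases "a < b") auto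
          qed
          have "n = 3" using near[of k i] near[of k i'] near[of i i'] k(1) i i' ki n3 by auto
          then have "{k, i, i'} = {..<n}" using k(1) i i' ki by auto
          then have "J = v ` {k, i, i'}" unfolding J_def by simp
          then have "\<forall>c\<in>J. D r c \<noteq> 0" using nz k r(5,6) i' by auto
          then show False using False r(1) by blast
        qed
        have two: "(\<Sum>j\<in>J. g j * h j) = g (v i) * h (v i) + g (v (Suc i)) * h (v (Suc i))"
          if "\<And>c. c \<in> J \<Longrightarrow> c \<noteq> v i \<Longrightarrow> c \<noteq> v (Suc i) \<Longrightarrow> h c = 0" for g h :: "'c \<Rightarrow> int"
        proof -
          have "(\<Sum>j\<in>J. g j * h j) = (\<Sum>j\<in>{v i, v (Suc i)}. g j * h j)"
            by (rule sum.mono_neutral_right) (use J(2) vJ i that in auto)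
          then show ?thesis using r(4) by simp
        qed
        have "(\<Sum>j\<in>J. e j * D r j) \<in> {-1, 0, 1}" using e(2) r(1) by blast
        then have 1: "D r (v i) * D r (v (Suc i)) = - (e (v i) * e (v (Suc i)))"
          using two[of "D r" e] only pm[OF r(1,2,5)] pm[OF r(1,3,6)] e(1)
          by (intro equitable_product) auto
        have only': "D' r c = 0" if "c \<in> J" "c \<noteq> v i" "c \<noteq> v (Suc i)" for c
          using only[OF that] supp r(1) J(1) that by blast
        have "(\<Sum>j\<in>J. e' j * D' r j) \<in> {-1, 0, 1}" using e'(2) r(1) by blast
        then have 2: "D' r (v i) * D' r (v (Suc i)) = - (e' (v i) * e' (v (Suc i)))"
          using two[of "D' r" e'] only' pm[OF r(1,2,5)] pm[OF r(1,3,6)] e'(1)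
          by (intro equitable_product) auto
        show ?thesis using r(7) 1 2 unfolding \<tau>_def by simp
      qed
      moreover have "e c * e' c \<in> {-1, 1}" for c using e(1)[rule_format, of c] e'(1)[rule_format, of c] by auto
      ultimately show ?thesis by (intro exI[of _ "\<lambda>c. e c * e' c"]) blast
    qed
    then obtain \<eta> where \<eta>: "\<And>c. c \<in> J \<Longrightarrow> \<eta> c \<in> {-1, 1::int}"
      "\<And>i. i < n \<Longrightarrow> s (Suc i) = s i * (\<eta> (v i) * \<eta> (v (Suc i)))" by blast
    have "s i * \<eta> (v i) = s 0 * \<eta> (v 0)" if "i \<le> n" for i
      using that
    proof (induction i)
      case (Suc i)
      then show ?case using \<eta>(2)[of i] \<eta>(1)[OF vJ, of i] \<eta>(1)[OF vJ, of "Suc i"] by auto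
    qed simp
    from this[of n] show False using sn vn \<eta>(1)[OF vJ, of 0] spm[of 0] by auto
  qed
  have star_pm: "s \<in> {-1, 1} \<and> v \<in> C" if "((u, 1), (v, s)) \<in> X\<^sup>*" "u \<in> C" for u v s
    using that(1) by (cases rule: rtranclE) (use that XE in fastforce)+
  have star_unique: "s = s'" if "((u, 1), (v, s)) \<in> X\<^sup>*" "((u, 1), (v, s')) \<in> X\<^sup>*" "u \<in> C" for u v s s'
  proof (rule ccontr)
    assume "s \<noteq> s'"
    moreover have "s \<in> {-1, 1}" "s' \<in> {-1, 1}"
      using star_pm[OF that(1,3)] star_pm[OF that(2,3)] by blast+
    ultimately have s': "s' = - s" "s \<noteq> 0" by auto
    have "((v, s), (v, - s)) \<in> X\<^sup>*"
      using that s' symD[OF sym_rtrancl[OF Xsym]] rtrancl_trans by metis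
    then obtain n where "((v, s), flip (v, s)) \<in> X ^^ n" unfolding flip_def using rtrancl_imp_relpow by fastforce
    then show False using no_bad s' by fastforce
  qed
  \<comment> \<open>balanced, so lifting from a chosen vertex of each component gives a well defined sign\<close>
  define P where "P v u \<longleftrightarrow> u \<in> C \<and> (\<exists>s. ((u, 1), (v, s)) \<in> X\<^sup>*)" for u v
  define rep where "rep v = (SOME u. P v u)" for v
  define \<epsilon> where "\<epsilon> v = (if v \<in> C then SOME s. ((rep v, 1), (v, s)) \<in> X\<^sup>* else 1)" for v
  have rep: "P v (rep v)" if "v \<in> C" for v
    unfolding rep_def by (rule someI[of _ v]) (use that in \<open>auto simp: P_def\<close>)
  have \<epsilon>: "((rep v, 1), (v, \<epsilon> v)) \<in> X\<^sup>*" if "v \<in> C" for v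
    unfolding \<epsilon>_def using rep[OF that] that unfolding P_def by (auto intro: someI)
  have \<epsilon>pm: "\<epsilon> v \<in> {-1, 1}" for v
  proof (cases "v \<in> C")
    case True
    then show ?thesis using star_pm[OF \<epsilon>[OF True]] rep[OF True] unfolding P_def by blast
  qed (simp add: \<epsilon>_def)
  have ext: "((u, 1), (w, s * \<tau> r v w)) \<in> X\<^sup>*"
    if "((u, 1), (v, s)) \<in> X\<^sup>*" "u \<in> C" "r \<in> R" "w \<in> C" "v \<noteq> w" "D r v \<noteq> 0" "D r w \<noteq> 0" for u v w s r
    using that star_pm[OF that(1,2)] by (blast intro: rtrancl_into_rtrancl XI)
  have "D' r i * D' r j = \<epsilon> i * \<epsilon> j * (D r i * D r j)"
    if r: "r \<in> R" "i \<in> C" "j \<in> C" "D r i \<noteq> 0" "D r j \<noteq> 0" for r i j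
  proof (cases "i = j")
    case True
    then show ?thesis using \<epsilon>pm[of i] pm[OF r(1,2,4)] by auto
  next
    case False
    have "P i u \<longleftrightarrow> P j u" for u
      unfolding P_def using ext[of u i _ r j] ext[of u j _ r i] r False by metis
    then have "rep i = rep j" unfolding rep_def by presburger
    then have "\<epsilon> j = \<epsilon> i * \<tau> r i j"
      using star_unique[OF \<epsilon>[OF r(3)]] ext[OF \<epsilon>[OF r(2)] _ r(1,3) False r(4,5)] rep[OF r(2)]
      unfolding P_def by metis
    then show ?thesis using \<epsilon>pm[of i] pm[OF r(1,2,4)] pm[OF r(1,3,5)] unfolding \<tau>_def by auto
  qed
  then show ?thesis using that[of \<epsilon>] \<epsilon>pm by blast
qed

lemma signed_equiv_if_same_support:
  fixes D :: "'r \<Rightarrow> 'c \<Rightarrow> int" and D' :: "'p \<Rightarrow> 'd \<Rightarrow> int"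
  assumes E: "equitable R C D" and E': "equitable R' C' D'"
    and \<rho>: "bij_betw \<rho> R R'" and \<sigma>: "bij_betw \<sigma> C C'"
    and supp: "\<And>r c. r \<in> R \<Longrightarrow> c \<in> C \<Longrightarrow> D r c = 0 \<longleftrightarrow> D' (\<rho> r) (\<sigma> c) = 0"
  shows "signed_equiv R C D R' C' D'"
proof -
  define D1 where "D1 r c = D' (\<rho> r) (\<sigma> c)" for r c
  have E1: "equitable R C D1"
    unfolding equitable_def
  proof (intro allI impI)
    fix J assume J: "J \<subseteq> C"
    then have inj: "inj_on \<sigma> J" using \<sigma> inj_on_subset unfolding bij_betw_def by blast
    have "\<sigma> ` J \<subseteq> C'" using J \<sigma> unfolding bij_betw_def by blast
    then obtain e where e: "\<forall>j. e j \<in> {-1, 1::int}" "\<forall>r\<in>R'. (\<Sum>j\<in>\<sigma> ` J. e j * D' r j) \<in> {-1, 0, 1}"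
      using E' unfolding equitable_def by blast
    have "(\<Sum>j\<in>J. e (\<sigma> j) * D1 r j) = (\<Sum>j\<in>\<sigma> ` J. e j * D' (\<rho> r) j)" for r
      unfolding D1_def using sum.reindex[OF inj, of "\<lambda>j. e j * D' (\<rho> r) j"] by simp
    moreover have "\<rho> r \<in> R'" if "r \<in> R" for r using \<rho> that by (rule bij_betw_apply)
    ultimately show "\<exists>\<epsilon>. (\<forall>j. \<epsilon> j \<in> {-1, 1}) \<and> (\<forall>r\<in>R. (\<Sum>j\<in>J. \<epsilon> j * D1 r j) \<in> {-1, 0, 1})"
      using e by (intro exI[of _ "\<lambda>j. e (\<sigma> j)"]) auto
  qed
  have supp1: "D r c = 0 \<longleftrightarrow> D1 r c = 0" if "r \<in> R" "c \<in> C" for r c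
    unfolding D1_def using supp that .
  obtain \<epsilon> where \<epsilon>: "\<And>c. \<epsilon> c \<in> {-1, 1::int}"
    and eq: "\<And>r i j. r \<in> R \<Longrightarrow> i \<in> C \<Longrightarrow> j \<in> C \<Longrightarrow> D r i \<noteq> 0 \<Longrightarrow> D r j \<noteq> 0 \<Longrightarrow>
      D1 r i * D1 r j = \<epsilon> i * \<epsilon> j * (D r i * D r j)"
    using signing_unique[OF E E1 supp1] by blast
  define p where "p r = (SOME c. c \<in> C \<and> D r c \<noteq> 0)" for r
  define \<eta> where "\<eta> r = (if r \<in> R \<and> (\<exists>c\<in>C. D r c \<noteq> 0) then \<epsilon> (p r) * (D r (p r) * D1 r (p r)) else 1)" for r
  have p: "p r \<in> C" "D r (p r) \<noteq> 0" if "\<exists>c\<in>C. D r c \<noteq> 0" for r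
    using someI_ex[of "\<lambda>c. c \<in> C \<and> D r c \<noteq> 0"] that unfolding p_def by blast+
  note en = equitable_entry[OF E] equitable_entry[OF E1]
  have \<eta>: "\<eta> r \<in> {-1, 1}" for r
  proof (cases "r \<in> R \<and> (\<exists>c\<in>C. D r c \<noteq> 0)")
    case True
    then show ?thesis
      using p[of r] en[of r "p r"] supp1[of r "p r"] \<epsilon>[of "p r"] unfolding \<eta>_def by auto
  next
    case False
    then have "\<eta> r = 1" unfolding \<eta>_def by (rule if_not_P)
    then show ?thesis by simp
  qed
  have "D1 r c = \<eta> r * \<epsilon> c * D r c" if r: "r \<in> R" "c \<in> C" for r c
  proof (cases "D r c = 0")
    case True then show ?thesis using supp1 r by simp
  next
    case False
    then have ex: "\<exists>c\<in>C. D r c \<noteq> 0" using r by blast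
    have "D1 r (p r) * D1 r c = \<epsilon> (p r) * \<epsilon> c * (D r (p r) * D r c)"
      using eq[OF r(1) p(1)[OF ex] r(2) p(2)[OF ex] False] .
    moreover have "D1 r (p r) \<in> {-1, 1}" "D r (p r) \<in> {-1, 1}"
      using p[OF ex] en[of r "p r"] supp1[of r "p r"] r(1) by auto
    moreover have "\<eta> r = \<epsilon> (p r) * (D r (p r) * D1 r (p r))" unfolding \<eta>_def using ex r(1) by simp
    ultimately show ?thesis by auto
  qed
  then show ?thesis unfolding signed_equiv_def D1_def using \<rho> \<sigma> \<eta> \<epsilon> by blast
qed

section \<open>Evaluation at a primitive eighth root of unity\<close>

text \<open>
  At \<open>q = zeta\<close> the bar involution becomes complex conjugation and \<open>q\<^sup>2\<close> becomes \<open>\<i>\<close>. So the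
  Gram matrix \<open>1 + q\<^sup>2 B\<close> splits into its hermitian part \<open>1\<close> and its antihermitian part \<open>\<i> B\<close>,
  and an isomorphism preserves both.
\<close>

definition zeta :: complex where "zeta = Complex (1 / sqrt 2) (1 / sqrt 2)"

definition ev :: "laurent \<Rightarrow> complex" where
  "ev f = (\<Sum>k\<in>Poly_Mapping.keys f. of_int (Poly_Mapping.lookup f k) * zeta powi k)"

lemma zeta_sq: "zeta ^ 2 = \<i>"
  by (simp add: zeta_def power2_eq_square complex_eq_iff)

lemma zeta_nz [simp]: "zeta \<noteq> 0"
  by (simp add: zeta_def complex_eq_iff)

lemma cnj_zeta: "cnj zeta = inverse zeta"
proof -
  have "cnj zeta * zeta = 1" by (simp add: zeta_def complex_eq_iff)
  then show ?thesis by (metis zeta_nz inverse_unique mult.commute)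
qed

lemma ev_superset:
  assumes "finite K" "Poly_Mapping.keys f \<subseteq> K"
  shows "ev f = (\<Sum>k\<in>K. of_int (Poly_Mapping.lookup f k) * zeta powi k)"
  unfolding ev_def using assms by (intro sum.mono_neutral_left) (auto simp: in_keys_iff)

lemma ev_diff: "ev (f - g) = ev f - ev g"
proof -
  let ?K = "Poly_Mapping.keys f \<union> Poly_Mapping.keys g"
  have "Poly_Mapping.keys (f - g) \<subseteq> ?K" by (rule keys_diff)
  then show ?thesis
    by (simp add: ev_superset[of ?K] lookup_minus left_diff_distrib sum_subtractf)
qed

lemma ev_0 [simp]: "ev 0 = 0" by (simp add: ev_def)

lemma ev_uminus: "ev (- f) = - ev f" using ev_diff[of 0 f] by simp

lemma ev_add: "ev (f + g) = ev f + ev g" using ev_diff[of f "- g"] by (simp add: ev_uminus)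

lemma ev_single: "ev (Poly_Mapping.single k 1) = zeta powi k"
  by (simp add: ev_def)

lemma ev_1 [simp]: "ev 1 = 1" using ev_single[of 0] by simp

lemma laurent_induct [case_names single diff]:
  fixes f :: laurent
  assumes "\<And>k. P (Poly_Mapping.single k 1)" "\<And>a b. P a \<Longrightarrow> P b \<Longrightarrow> P (a - b)"
  shows "P f"
proof -
  have "P 0" using assms(2)[OF assms(1) assms(1), of 0 0] by simp
  then show ?thesis by (intro frag_induction[of f UNIV P]) (use assms in auto)
qed

lemma ev_mult: "ev (f * g) = ev f * ev g"
proof (induction f rule: laurent_induct)
  case (single k)
  show ?case
  proof (induction g rule: laurent_induct)
    case (single l)
    show ?case by (simp add: mult_single ev_single power_int_add)
  qed (simp add: right_diff_distrib ev_diff)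
qed (simp add: left_diff_distrib ev_diff)

lemma ev_sum: "ev (sum f A) = (\<Sum>a\<in>A. ev (f a))"
  by (induction A rule: infinite_finite_induct) (auto simp: ev_add)

lemma ev_of_int: "ev (of_int n) = of_int n"
  by (induction n rule: int_induct[of _ 0]) (auto simp: ev_add ev_diff)

lemma ev_q2: "ev (laurent_q ^ 2) = \<i>"
  by (simp add: power2_eq_square ev_mult laurent_q_def ev_single flip: zeta_sq)

lemma inj_uminus_int: "inj (uminus :: int \<Rightarrow> int)" by (simp add: inj_def)

lemma laurent_bar_add: "laurent_bar (f + g) = laurent_bar f + laurent_bar g"
  unfolding laurent_bar_def by (rule map_key_plus[OF inj_uminus_int])

lemma laurent_bar_0 [simp]: "laurent_bar 0 = 0"
  unfolding laurent_bar_def by (rule map_key_zero[OF inj_uminus_int])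

lemma laurent_bar_uminus: "laurent_bar (- f) = - laurent_bar f"
proof -
  have "laurent_bar (- f) + laurent_bar f = 0" by (simp flip: laurent_bar_add)
  then show ?thesis by (simp add: eq_neg_iff_add_eq_0)
qed

lemma laurent_bar_diff: "laurent_bar (f - g) = laurent_bar f - laurent_bar g"
  using laurent_bar_add[of f "- g"] by (simp add: laurent_bar_uminus)

lemma laurent_bar_single: "laurent_bar (Poly_Mapping.single k c) = Poly_Mapping.single (- k) c"
  unfolding laurent_bar_def using map_key_single[OF inj_uminus_int, of "- k" c] by simp

lemma laurent_bar_1 [simp]: "laurent_bar 1 = 1" using laurent_bar_single[of 0 1] by simp

lemma ev_bar: "ev (laurent_bar f) = cnj (ev f)"
proof (induction f rule: laurent_induct)
  case (single k)
  have "cnj (zeta powi k) = cnj zeta powi k" by (simp add: power_int_def)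
  also have "\<dots> = zeta powi (- k)" by (simp add: cnj_zeta power_int_inverse power_int_minus)
  finally show ?case by (simp add: laurent_bar_single ev_single)
qed (simp add: laurent_bar_diff ev_diff)

text \<open>
  The element \<open>a + b \<zeta> + c \<zeta>\<^sup>2 + d \<zeta>\<^sup>3\<close> of the ring of integers \<open>\<int>[\<zeta>]\<close>.
\<close>

definition cyc8 :: "int \<Rightarrow> int \<Rightarrow> int \<Rightarrow> int \<Rightarrow> complex" where
  "cyc8 a b c d = Complex (a + (b - d) / sqrt 2) (c + (b + d) / sqrt 2)"

lemma cyc8_diff: "cyc8 a b c d - cyc8 a' b' c' d' = cyc8 (a - a') (b - b') (c - c') (d - d')"
  by (simp add: cyc8_def complex_eq_iff field_simps)

lemma cyc8_mult_zeta: "cyc8 a b c d * zeta = cyc8 (- d) a b c"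
  by (simp add: cyc8_def zeta_def complex_eq_iff field_simps)

lemma cyc8_div_zeta: "cyc8 a b c d / zeta = cyc8 b c d (- a)"
  using cyc8_mult_zeta[of b c d "- a"] by (simp add: field_simps)

lemma ev_in_cyc8: "\<exists>a b c d. ev f = cyc8 a b c d"
proof (induction f rule: laurent_induct)
  case (single k)
  have "\<exists>a b c d. zeta powi k = cyc8 a b c d"
  proof (induction k rule: int_induct[of _ 0])
    case base
    have "zeta powi 0 = cyc8 1 0 0 0" by (simp add: cyc8_def complex_eq_iff)
    then show ?case by blast
  next
    case (step1 k)
    then show ?case by (metis cyc8_mult_zeta power_int_add_1 zeta_nz)
  next
    case (step2 k)
    have "zeta powi (k - 1) = zeta powi k / zeta" by (simp add: power_int_diff)
    then show ?case using step2 cyc8_div_zeta by metis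
  qed
  then show ?case by (simp add: ev_single)
next
  case (diff f g)
  then show ?case by (metis cyc8_diff ev_diff)
qed

lemma cyc8_norm:
  "cnj (cyc8 a b c d) * cyc8 a b c d =
    of_real (of_int (a^2 + b^2 + c^2 + d^2) + sqrt 2 * of_int (a*b + b*c + c*d - a*d))"
  by (simp add: cyc8_def complex_eq_iff field_simps power2_eq_square)

lemma twice_square_is_no_square:
  fixes x y :: int
  assumes "x * x = 2 * (y * y)"
  shows "y = 0"
  using assms
proof (induction "nat \<bar>y\<bar>" arbitrary: x y rule: less_induct)
  case less
  have "even (x * x)" using less(2) by simp
  then obtain x' where x: "x = 2 * x'" by auto
  have y: "y * y = 2 * (x' * x')" using less(2) unfolding x by simp
  have "even (y * y)" using y by simp
  then obtain y' where y': "y = 2 * y'" by auto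
  have "x' * x' = 2 * (y' * y')" using y unfolding y' by simp
  moreover have "nat \<bar>y'\<bar> < nat \<bar>y\<bar>" if "y' \<noteq> 0" using that by (simp add: y' abs_mult)
  ultimately have "y' = 0" using less(1)[of y' x'] by blast
  then show ?case using y' by simp
qed

text \<open>
  Comparison of coefficients in \<open>\<int>[\<surd>2]\<close>, by the irrationality of \<open>\<surd>2\<close>.
\<close>

lemma sqrt2_combination_eq_1:
  fixes x y :: int
  assumes "of_int x + sqrt 2 * of_int y = (1 :: real)"
  shows "x = 1"
proof -
  have "(of_int (1 - x) :: real) = sqrt 2 * of_int y" using assms by simp
  then have "(of_int (1 - x) :: real) * of_int (1 - x) = (sqrt 2 * of_int y) * (sqrt 2 * of_int y)" by simp
  also have "\<dots> = (sqrt 2 * sqrt 2) * (of_int y * of_int y)" by (simp only: ac_simps)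
  finally have "(of_int (1 - x) :: real) * of_int (1 - x) = 2 * (of_int y * of_int y)" by simp
  then have "(1 - x) * (1 - x) = 2 * (y * y)" by (metis of_int_eq_iff of_int_mult of_int_numeral)
  then have "y = 0" by (rule twice_square_is_no_square)
  then show ?thesis using assms by simp
qed

lemma sum_nonneg_int_eq_1:
  fixes N :: "'a \<Rightarrow> int"
  assumes "finite B" "\<And>k. k \<in> B \<Longrightarrow> N k \<ge> 0" "sum N B = 1"
  obtains k where "k \<in> B" "N k = 1" "\<And>l. l \<in> B \<Longrightarrow> l \<noteq> k \<Longrightarrow> N l = 0"
proof -
  obtain k where k: "k \<in> B" "N k \<noteq> 0" using assms(3) by (metis sum.neutral zero_neq_one)
  have "sum N B = N k + sum N (B - {k})" using assms(1) k(1) by (rule sum.remove)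
  moreover have "sum N (B - {k}) \<ge> 0" using assms(2) by (intro sum_nonneg) auto
  ultimately have "N k = 1" "sum N (B - {k}) = 0" using assms(2)[OF k(1)] assms(3) k(2) by linarith+
  then have "\<forall>l\<in>B - {k}. N l = 0"
    using sum_nonneg_eq_0_iff[of "B - {k}" N] assms(1,2) by auto
  then show ?thesis using that[OF k(1) \<open>N k = 1\<close>] by blast
qed

text \<open>
  The power \<open>zeta ^ r\<close> for \<open>r < 4\<close>, in coordinates.
\<close>

definition root8 :: "nat \<Rightarrow> complex" where
  "root8 r = (if r = 0 then 1 else if r = 1 then Complex (1 / sqrt 2) (1 / sqrt 2)
    else if r = 2 then \<i> else Complex (- 1 / sqrt 2) (1 / sqrt 2))"

lemma cyc8_unit:
  assumes "a^2 + b^2 + c^2 + d^2 = 1"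
  shows "\<exists>e r. e \<in> {-1, 1::int} \<and> r < 4 \<and> cyc8 a b c d = of_int e * root8 r"
proof -
  have nn: "a^2 \<ge> 0" "b^2 \<ge> 0" "c^2 \<ge> 0" "d^2 \<ge> 0" by simp_all
  have sq: "x \<in> {-1, 1}" if "x^2 = 1" for x :: int using that by (simp add: power2_eq_1_iff disj_commute)
  have pos: "x^2 \<ge> 1" if "x \<noteq> 0" for x :: int
    using that by (simp add: int_one_le_iff_zero_less)
  consider "a \<noteq> 0" | "b \<noteq> 0" | "c \<noteq> 0" | "d \<noteq> 0" using assms by fastforce
  then show ?thesis
  proof cases
    case 1
    then have "a^2 = 1" "b^2 = 0" "c^2 = 0" "d^2 = 0" using pos[OF 1] nn assms by linarith+
    then have "a \<in> {-1, 1}" "b = 0" "c = 0" "d = 0" using sq by auto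
    then show ?thesis
      by (intro exI[of _ a] exI[of _ 0]) (auto simp: cyc8_def root8_def complex_eq_iff)
  next
    case 2
    then have "b^2 = 1" "a^2 = 0" "c^2 = 0" "d^2 = 0" using pos[OF 2] nn assms by linarith+
    then have "b \<in> {-1, 1}" "a = 0" "c = 0" "d = 0" using sq by auto
    then show ?thesis
      by (intro exI[of _ b] exI[of _ 1]) (auto simp: cyc8_def root8_def complex_eq_iff)
  next
    case 3
    then have "c^2 = 1" "a^2 = 0" "b^2 = 0" "d^2 = 0" using pos[OF 3] nn assms by linarith+
    then have "c \<in> {-1, 1}" "a = 0" "b = 0" "d = 0" using sq by auto
    then show ?thesis
      by (intro exI[of _ c] exI[of _ 2]) (auto simp: cyc8_def root8_def complex_eq_iff)
  next
    case 4
    then have "d^2 = 1" "a^2 = 0" "b^2 = 0" "c^2 = 0" using pos[OF 4] nn assms by linarith+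
    then have "d \<in> {-1, 1}" "a = 0" "b = 0" "c = 0" using sq by auto
    then show ?thesis
      by (intro exI[of _ d] exI[of _ 3]) (auto simp: cyc8_def root8_def complex_eq_iff)
  qed
qed

text \<open>
  The squared absolute values of elements of \<open>\<int>[\<zeta>]\<close> lie in \<open>\<int>[\<surd>2]\<close>, and their
  rational part is the sum of the squares of the four coordinates. A vector of length \<open>1\<close> therefore has
  a single nonzero coordinate altogether.
\<close>

lemma unit_column:
  fixes s :: "'b \<Rightarrow> complex"
  assumes fin: "finite B" and s: "\<And>k. k \<in> B \<Longrightarrow> \<exists>a b c d. s k = cyc8 a b c d"
    and one: "(\<Sum>k\<in>B. cnj (s k) * s k) = 1"
  shows "\<exists>k e r. k \<in> B \<and> e \<in> {-1, 1::int} \<and> r < 4 \<and> s k = of_int e * root8 r \<and>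
    (\<forall>l\<in>B. l \<noteq> k \<longrightarrow> s l = 0)"
proof -
  obtain a b c d where abcd: "\<And>k. k \<in> B \<Longrightarrow> s k = cyc8 (a k) (b k) (c k) (d k)"
    using s by metis
  define N where "N k = (a k)^2 + (b k)^2 + (c k)^2 + (d k)^2" for k
  define M where "M k = a k * b k + b k * c k + c k * d k - a k * d k" for k
  have "(\<Sum>k\<in>B. cnj (s k) * s k) = (\<Sum>k\<in>B. of_real (of_int (N k) + sqrt 2 * of_int (M k)))"
    by (rule sum.cong) (simp_all only: abcd cyc8_norm N_def M_def)
  also have "\<dots> = of_real (of_int (sum N B) + sqrt 2 * of_int (sum M B))"
    by (simp add: sum.distrib sum_distrib_left)
  finally have "of_real (of_int (sum N B) + sqrt 2 * of_int (sum M B)) = (1 :: complex)" using one by simp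
  then have "of_int (sum N B) + sqrt 2 * of_int (sum M B) = (1 :: real)" using of_real_eq_1_iff by blast
  then have sumN: "sum N B = 1" by (rule sqrt2_combination_eq_1)
  have "N k \<ge> 0" for k unfolding N_def by simp
  then obtain k where k: "k \<in> B" "N k = 1" "\<And>l. l \<in> B \<Longrightarrow> l \<noteq> k \<Longrightarrow> N l = 0"
    using sum_nonneg_int_eq_1[OF fin _ sumN] by metis
  have "s l = 0" if "l \<in> B" "l \<noteq> k" for l
  proof -
    have "(a l)^2 + (b l)^2 + (c l)^2 + (d l)^2 = 0" using k(3)[OF that] unfolding N_def .
    moreover have "(a l)^2 \<ge> 0" "(b l)^2 \<ge> 0" "(c l)^2 \<ge> 0" "(d l)^2 \<ge> 0" by simp_all
    ultimately have "(a l)^2 = 0" "(b l)^2 = 0" "(c l)^2 = 0" "(d l)^2 = 0" by linarith+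
    then show ?thesis using abcd[OF that(1)] by (simp add: cyc8_def complex_eq_iff)
  qed
  moreover obtain e r where "e \<in> {-1, 1::int}" "r < 4" "s k = of_int e * root8 r"
    using cyc8_unit[OF k(2)[unfolded N_def]] abcd[OF k(1)] by auto
  ultimately show ?thesis using k(1) by blast
qed

text \<open>
  The quotient of two distinct powers \<open>zeta ^ r\<close>, \<open>r < 4\<close>, is not real, so distinct powers force both
  integers to vanish.
\<close>

lemma root8_quotient_int:
  assumes "cnj (of_int e * root8 r) * (of_int e' * root8 r') * of_int b = (of_int a :: complex)"
    and "r < 4" "r' < 4" "e \<in> {-1, 1}" "e' \<in> {-1, 1}"
  shows "a = e * e' * b"
proof -
  have "r \<in> {0, 1, 2, 3}" "r' \<in> {0, 1, 2, 3}" using assms(2,3) by auto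
  then show ?thesis using assms(1,4,5)
    by (auto simp: root8_def complex_eq_iff)
qed

section \<open>Isomorphisms of free q-lattices\<close>

definition q_gram :: "('b \<Rightarrow> 'b \<Rightarrow> int) \<Rightarrow> 'b \<Rightarrow> 'b \<Rightarrow> laurent" where
  "q_gram b i j = of_bool (i = j) + of_int (b i j) * laurent_q ^ 2"

lemma ev_q_gram: "ev (q_gram b i j) = of_bool (i = j) + \<i> * of_int (b i j)"
  by (simp add: q_gram_def ev_add ev_mult ev_of_int ev_q2)

lemma q_lattices_isomorphic_sym:
  assumes "q_lattices_isomorphic (free_q_lattice B1 A1) (free_q_lattice B2 A2)"
  shows "q_lattices_isomorphic (free_q_lattice B2 A2) (free_q_lattice B1 A1)"
proof -
  let ?L = "free_q_lattice B1 A1" and ?M = "free_q_lattice B2 A2"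
  obtain \<phi> where \<phi>: "q_lattice_iso ?L ?M \<phi>" using assms unfolding q_lattices_isomorphic_def by blast
  define \<psi> where "\<psi> = inv_into (vectors ?L) \<phi>"
  have bij: "bij_betw \<phi> (vectors ?L) (vectors ?M)"
    and add: "\<And>x y. x \<in> vectors ?L \<Longrightarrow> y \<in> vectors ?L \<Longrightarrow> \<phi> (\<lambda>b. x b + y b) = (\<lambda>d. \<phi> x d + \<phi> y d)"
    and scale: "\<And>f x. x \<in> vectors ?L \<Longrightarrow> \<phi> (\<lambda>b. f * x b) = (\<lambda>d. f * \<phi> x d)"
    and form: "\<And>x y. x \<in> vectors ?L \<Longrightarrow> y \<in> vectors ?L \<Longrightarrow> form ?M (\<phi> x) (\<phi> y) = form ?L x y"
    using \<phi> unfolding q_lattice_iso_def by blast+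
  have \<psi>: "\<psi> y \<in> vectors ?L" "\<phi> (\<psi> y) = y" if "y \<in> vectors ?M" for y
    using bij that unfolding \<psi>_def
    by (auto simp: bij_betw_def inv_into_into f_inv_into_f)
  have \<psi>\<phi>: "\<psi> (\<phi> x) = x" if "x \<in> vectors ?L" for x
    unfolding \<psi>_def using bij that by (simp add: bij_betw_def)
  have cl: "(\<lambda>b. x b + y b) \<in> vectors ?L" "(\<lambda>b. f * x b) \<in> vectors ?L"
    if "x \<in> vectors ?L" "y \<in> vectors ?L" for x y f
    using that unfolding free_q_lattice_def by auto
  have "q_lattice_iso ?M ?L \<psi>"
    unfolding q_lattice_iso_def
  proof (intro conjI ballI allI)
    show "bij_betw \<psi> (vectors ?M) (vectors ?L)" unfolding \<psi>_def by (rule bij_betw_inv_into[OF bij])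
  next
    fix x y assume xy: "x \<in> vectors ?M" "y \<in> vectors ?M"
    have "\<phi> (\<lambda>b. \<psi> x b + \<psi> y b) = (\<lambda>d. x d + y d)" using add \<psi> xy by simp
    then show "\<psi> (\<lambda>b. x b + y b) = (\<lambda>d. \<psi> x d + \<psi> y d)"
      using \<psi>\<phi>[OF cl(1)[OF \<psi>(1)[OF xy(1)] \<psi>(1)[OF xy(2)]]] by simp
  next
    fix f x assume x: "x \<in> vectors ?M"
    have "\<phi> (\<lambda>b. f * \<psi> x b) = (\<lambda>d. f * x d)" using scale \<psi> x by simp
    then show "\<psi> (\<lambda>b. f * x b) = (\<lambda>d. f * \<psi> x d)"
      using \<psi>\<phi>[OF cl(2)[OF \<psi>(1)[OF x] \<psi>(1)[OF x]], of f] by simp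
  next
    fix x y assume xy: "x \<in> vectors ?M" "y \<in> vectors ?M"
    show "form ?L (\<psi> x) (\<psi> y) = form ?M x y" using form[of "\<psi> x" "\<psi> y"] \<psi> xy by simp
  qed
  then show ?thesis unfolding q_lattices_isomorphic_def by blast
qed

text \<open>
  Let \<open>S\<close> be the matrix of the isomorphism at \<open>q = zeta\<close>. Preservation of the forms reads
  \<open>S\<^sup>* (1 + \<i> b2) S = 1 + \<i> b1\<close>; since \<open>b1\<close> and \<open>b2\<close> are real symmetric, adding and
  subtracting the conjugate transpose gives \<open>P = S\<^sup>* S = 1\<close> and \<open>Q = S\<^sup>* b2 S = b1\<close>. By the former
  every column of \<open>S\<close> has a single nonzero entry, a unit \<open>\<plusminus>zeta ^ r\<close>, and by the latter the
  powers of \<open>zeta\<close> cancel wherever \<open>b2\<close> does not vanish.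
\<close>

lemma basis_image_of_iso:
  fixes B1 :: "'b set" and B2 :: "'d set"
  assumes fin: "finite B1" "finite B2"
    and sym: "\<And>i j. b1 i j = b1 j i" "\<And>i j. b2 i j = b2 j i"
    and iso: "q_lattices_isomorphic (free_q_lattice B1 (q_gram b1)) (free_q_lattice B2 (q_gram b2))"
  shows "\<exists>\<sigma> \<epsilon>. inj_on \<sigma> B1 \<and> \<sigma> ` B1 \<subseteq> B2 \<and> (\<forall>c. \<epsilon> c \<in> {-1, 1}) \<and>
    (\<forall>i\<in>B1. \<forall>j\<in>B1. b2 (\<sigma> i) (\<sigma> j) = \<epsilon> i * \<epsilon> j * b1 i j)"
proof -
  let ?L = "free_q_lattice B1 (q_gram b1)" and ?M = "free_q_lattice B2 (q_gram b2)"
  obtain \<phi> where \<phi>: "q_lattice_iso ?L ?M \<phi>" using iso unfolding q_lattices_isomorphic_def by blast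
  define e :: "'b \<Rightarrow> 'b \<Rightarrow> laurent" where "e c b = of_bool (b = c)" for c b
  have e: "e c \<in> vectors ?L" if "c \<in> B1" for c
    using that unfolding e_def free_q_lattice_def by auto
  define S where "S k i = ev (\<phi> (e i) k)" for k i
  have eL: "form ?L (e i) (e j) = q_gram b1 i j" if "i \<in> B1" "j \<in> B1" for i j
  proof -
    have "form ?L (e i) (e j) = (\<Sum>k\<in>B1. \<Sum>l\<in>B1. of_bool (k = i) * q_gram b1 k l * of_bool (l = j))"
      unfolding free_q_lattice_def e_def by (simp add: of_bool_def if_distrib cong: if_cong)
    also have "\<dots> = (\<Sum>k\<in>{i}. \<Sum>l\<in>B1. of_bool (k = i) * q_gram b1 k l * of_bool (l = j))"
      using fin(1) that by (intro sum.mono_neutral_right) auto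
    also have "\<dots> = (\<Sum>l\<in>{j}. q_gram b1 i l * of_bool (l = j))"
      using fin(1) that by simp
    also have "\<dots> = q_gram b1 i j" by simp
    finally show ?thesis .
  qed
  define P where "P i j = (\<Sum>k\<in>B2. cnj (S k i) * S k j)" for i j
  define Q where "Q i j = (\<Sum>k\<in>B2. \<Sum>l\<in>B2. cnj (S k i) * of_int (b2 k l) * S l j)" for i j
  have PQ: "P i j + \<i> * Q i j = of_bool (i = j) + \<i> * of_int (b1 i j)" if "i \<in> B1" "j \<in> B1" for i j
  proof -
    have "ev (form ?M (\<phi> (e i)) (\<phi> (e j))) = ev (q_gram b1 i j)"
      using \<phi> e that eL unfolding q_lattice_iso_def by simp
    moreover have "ev (form ?M (\<phi> (e i)) (\<phi> (e j))) =
      (\<Sum>k\<in>B2. \<Sum>l\<in>B2. cnj (S k i) * (of_bool (k = l) + \<i> * of_int (b2 k l)) * S l j)"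
      unfolding free_q_lattice_def S_def by (simp add: ev_sum ev_mult ev_bar ev_q_gram)
    moreover have "\<dots> = (\<Sum>k\<in>B2. \<Sum>l\<in>B2. cnj (S k i) * of_bool (k = l) * S l j) + \<i> * Q i j"
      unfolding Q_def sum_distrib_left sum.distrib[symmetric]
      by (intro sum.cong refl) (simp add: algebra_simps)
    moreover have "(\<Sum>k\<in>B2. \<Sum>l\<in>B2. cnj (S k i) * of_bool (k = l) * S l j) = P i j"
      unfolding P_def
    proof (rule sum.cong[OF refl])
      fix k assume k: "k \<in> B2"
      have "(\<Sum>l\<in>B2. cnj (S k i) * of_bool (k = l) * S l j) =
          (\<Sum>l\<in>{k}. cnj (S k i) * of_bool (k = l) * S l j)"
        using fin(2) k by (intro sum.mono_neutral_right) auto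
      then show "(\<Sum>l\<in>B2. cnj (S k i) * of_bool (k = l) * S l j) = cnj (S k i) * S k j" by simp
    qed
    ultimately show ?thesis by (simp add: ev_q_gram)
  qed
  have cnjP: "cnj (P j i) = P i j" for i j
    unfolding P_def by (simp add: mult.commute)
  have cnjQ: "cnj (Q j i) = Q i j" for i j
  proof -
    have "cnj (Q j i) = (\<Sum>k\<in>B2. \<Sum>l\<in>B2. cnj (S l i) * of_int (b2 l k) * S k j)"
      unfolding Q_def by (simp add: sym(2) ac_simps)
    also have "\<dots> = Q i j" unfolding Q_def by (rule sum.swap)
    finally show ?thesis .
  qed
  have P: "P i j = of_bool (i = j)" and Q: "Q i j = of_int (b1 i j)" if ij: "i \<in> B1" "j \<in> B1" for i j
  proof -
    have "cnj (P j i + \<i> * Q j i) = cnj (of_bool (j = i) + \<i> * of_int (b1 j i))"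
      using PQ[OF ij(2,1)] by simp
    then have "P i j - \<i> * Q i j = of_bool (i = j) - \<i> * of_int (b1 i j)"
      by (simp add: cnjP cnjQ sym(1)[of j i] eq_commute[of j i])
    then show "P i j = of_bool (i = j)" "Q i j = of_int (b1 i j)"
      using PQ[OF ij] by (cases "i = j"; simp add: complex_eq_iff)+
  qed
  have "\<forall>i\<in>B1. \<exists>k e r. k \<in> B2 \<and> e \<in> {-1, 1::int} \<and> r < 4 \<and> S k i = of_int e * root8 r \<and>
    (\<forall>l\<in>B2. l \<noteq> k \<longrightarrow> S l i = 0)"
  proof
    fix i assume i: "i \<in> B1"
    have "(\<Sum>k\<in>B2. cnj (S k i) * S k i) = 1" using P[OF i i] unfolding P_def by simp
    then show "\<exists>k e r. k \<in> B2 \<and> e \<in> {-1, 1::int} \<and> r < 4 \<and> S k i = of_int e * root8 r \<and>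
      (\<forall>l\<in>B2. l \<noteq> k \<longrightarrow> S l i = 0)"
      by (intro unit_column[OF fin(2)]) (simp_all add: S_def ev_in_cyc8)
  qed
  then obtain \<sigma> \<epsilon> r where \<sigma>: "\<And>i. i \<in> B1 \<Longrightarrow> \<sigma> i \<in> B2 \<and> \<epsilon> i \<in> {-1, 1::int} \<and> r i < (4::nat) \<and>
    S (\<sigma> i) i = of_int (\<epsilon> i) * root8 (r i) \<and> (\<forall>l\<in>B2. l \<noteq> \<sigma> i \<longrightarrow> S l i = 0)"
    by metis
  have nz: "S (\<sigma> i) i \<noteq> 0" if "i \<in> B1" for i
  proof -
    have "S (\<sigma> i) i = of_int (\<epsilon> i) * root8 (r i)" "\<epsilon> i \<in> {-1, 1}" using \<sigma>[OF that] by blast+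
    moreover have "root8 (r i) \<noteq> 0" unfolding root8_def by (auto simp: complex_eq_iff)
    ultimately show ?thesis by auto
  qed
  have inj: "inj_on \<sigma> B1"
  proof (rule inj_onI, rule ccontr)
    fix i j assume ij: "i \<in> B1" "j \<in> B1" "\<sigma> i = \<sigma> j" "i \<noteq> j"
    have "P i j = (\<Sum>k\<in>{\<sigma> i}. cnj (S k i) * S k j)"
      unfolding P_def using \<sigma>[OF ij(1)] fin(2) by (intro sum.mono_neutral_right) auto
    then have "P i j = cnj (S (\<sigma> i) i) * S (\<sigma> j) j" using ij by simp
    then show False using P[OF ij(1,2)] ij(4) nz[OF ij(1)] nz[OF ij(2)] by simp
  qed
  have "b1 i j = \<epsilon> i * \<epsilon> j * b2 (\<sigma> i) (\<sigma> j)" if ij: "i \<in> B1" "j \<in> B1" for i j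
  proof -
    have "Q i j = (\<Sum>k\<in>{\<sigma> i}. \<Sum>l\<in>B2. cnj (S k i) * of_int (b2 k l) * S l j)"
      unfolding Q_def using \<sigma>[OF ij(1)] fin(2) by (intro sum.mono_neutral_right) auto
    also have "\<dots> = (\<Sum>l\<in>B2. cnj (S (\<sigma> i) i) * of_int (b2 (\<sigma> i) l) * S l j)" by simp
    also have "\<dots> = (\<Sum>l\<in>{\<sigma> j}. cnj (S (\<sigma> i) i) * of_int (b2 (\<sigma> i) l) * S l j)"
      using \<sigma>[OF ij(2)] fin(2) by (intro sum.mono_neutral_right) auto
    finally have "cnj (of_int (\<epsilon> i) * root8 (r i)) * (of_int (\<epsilon> j) * root8 (r j)) * of_int (b2 (\<sigma> i) (\<sigma> j))
      = (of_int (b1 i j) :: complex)"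
      using Q[OF ij] \<sigma>[OF ij(1)] \<sigma>[OF ij(2)] by (simp add: ac_simps)
    then show ?thesis by (rule root8_quotient_int) (use \<sigma>[OF ij(1)] \<sigma>[OF ij(2)] in blast)+
  qed
  then have eq: "b2 (\<sigma> i) (\<sigma> j) = \<epsilon> i * \<epsilon> j * b1 i j" if "i \<in> B1" "j \<in> B1" for i j
    using that \<sigma>[OF that(1)] \<sigma>[OF that(2)] by auto
  define \<epsilon>' where "\<epsilon>' i = (if i \<in> B1 then \<epsilon> i else 1)" for i
  have "\<forall>c. \<epsilon>' c \<in> {-1, 1}" unfolding \<epsilon>'_def using \<sigma> by auto
  moreover have "\<forall>i\<in>B1. \<forall>j\<in>B1. b2 (\<sigma> i) (\<sigma> j) = \<epsilon>' i * \<epsilon>' j * b1 i j"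
    using eq unfolding \<epsilon>'_def by simp
  moreover have "\<sigma> ` B1 \<subseteq> B2" using \<sigma> by blast
  ultimately show ?thesis using inj by blast
qed

lemma laurent_bar_sign: "e \<in> {-1, 1} \<Longrightarrow> laurent_bar (of_int e * f) = of_int e * laurent_bar f"
  by (auto simp: laurent_bar_uminus)

text \<open>
  The map on basis indices from an isomorphism is injective; comparing cardinalities with the
  one from the inverse shows that it is bijective.
\<close>

lemma free_q_lattices_isomorphic_iff:
  fixes B1 :: "'b set" and B2 :: "'d set"
  assumes fin: "finite B1" "finite B2"
    and sym: "\<And>i j. b1 i j = b1 j i" "\<And>i j. b2 i j = b2 j i"
  shows "q_lattices_isomorphic (free_q_lattice B1 (q_gram b1)) (free_q_lattice B2 (q_gram b2)) \<longleftrightarrow>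
    forms_equiv B1 b1 B2 b2"
proof
  assume iso: "q_lattices_isomorphic (free_q_lattice B1 (q_gram b1)) (free_q_lattice B2 (q_gram b2))"
  obtain \<sigma> \<epsilon> where \<sigma>: "inj_on \<sigma> B1" "\<sigma> ` B1 \<subseteq> B2" "\<forall>c. \<epsilon> c \<in> {-1, 1::int}"
    "\<forall>i\<in>B1. \<forall>j\<in>B1. b2 (\<sigma> i) (\<sigma> j) = \<epsilon> i * \<epsilon> j * b1 i j"
    using basis_image_of_iso[OF fin sym iso] by blast
  obtain \<sigma>' \<epsilon>' where \<sigma>': "inj_on \<sigma>' B2" "\<sigma>' ` B2 \<subseteq> B1"
    using basis_image_of_iso[OF fin(2,1) sym(2,1) q_lattices_isomorphic_sym[OF iso]] by blast
  have "card B2 \<le> card B1" using card_inj_on_le[OF \<sigma>' fin(1)] .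
  then have "\<sigma> ` B1 = B2" using card_subset_eq[OF fin(2) \<sigma>(2)] card_image[OF \<sigma>(1)] card_mono[OF fin(2) \<sigma>(2)] by simp
  then have "bij_betw \<sigma> B1 B2" using \<sigma>(1) by (simp add: bij_betw_def)
  then show "forms_equiv B1 b1 B2 b2" unfolding forms_equiv_def using \<sigma>(3,4) by blast
next
  assume "forms_equiv B1 b1 B2 b2"
  then obtain \<sigma> \<epsilon> where \<sigma>: "bij_betw \<sigma> B1 B2" and \<epsilon>: "\<And>c. \<epsilon> c \<in> {-1, 1::int}"
    and eq: "\<And>i j. i \<in> B1 \<Longrightarrow> j \<in> B1 \<Longrightarrow> b2 (\<sigma> i) (\<sigma> j) = \<epsilon> i * \<epsilon> j * b1 i j"
    unfolding forms_equiv_def by blast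
  let ?L = "free_q_lattice B1 (q_gram b1)" and ?M = "free_q_lattice B2 (q_gram b2)"
  have \<epsilon>2: "\<epsilon> c * \<epsilon> c = 1" for c using \<epsilon>[of c] by auto
  have \<epsilon>2L: "of_int (\<epsilon> c) * (of_int (\<epsilon> c) * f) = f" for c and f :: laurent
    using \<epsilon>[of c] by auto
  define \<tau> where "\<tau> = inv_into B1 \<sigma>"
  have \<tau>: "\<tau> d \<in> B1" "\<sigma> (\<tau> d) = d" if "d \<in> B2" for d
    using \<sigma> that unfolding \<tau>_def by (auto simp: bij_betw_def inv_into_into f_inv_into_f)
  have \<sigma>B: "\<sigma> c \<in> B2" "\<tau> (\<sigma> c) = c" if "c \<in> B1" for c
    using \<sigma> that unfolding \<tau>_def by (auto simp: bij_betw_def)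
  define \<phi> where "\<phi> x d = (if d \<in> B2 then of_int (\<epsilon> (\<tau> d)) * x (\<tau> d) else 0)" for x :: "'b \<Rightarrow> laurent" and d
  define \<psi> where "\<psi> y c = (if c \<in> B1 then of_int (\<epsilon> c) * y (\<sigma> c) else 0)" for y :: "'d \<Rightarrow> laurent" and c
  have vL: "x \<in> vectors ?L \<longleftrightarrow> (\<forall>b. b \<notin> B1 \<longrightarrow> x b = 0)" for x unfolding free_q_lattice_def by simp
  have vM: "y \<in> vectors ?M \<longleftrightarrow> (\<forall>b. b \<notin> B2 \<longrightarrow> y b = 0)" for y unfolding free_q_lattice_def by simp
  have "q_lattice_iso ?L ?M \<phi>"
    unfolding q_lattice_iso_def
  proof (intro conjI ballI allI)
    show "bij_betw \<phi> (vectors ?L) (vectors ?M)"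
    proof (rule bij_betw_byWitness[of _ \<psi>])
      show "\<forall>x\<in>vectors ?L. \<psi> (\<phi> x) = x"
        by (auto simp: vL fun_eq_iff \<phi>_def \<psi>_def \<sigma>B \<epsilon>2L)
      show "\<forall>y\<in>vectors ?M. \<phi> (\<psi> y) = y"
        by (auto simp: vM fun_eq_iff \<phi>_def \<psi>_def \<tau> \<epsilon>2L)
      show "\<phi> ` vectors ?L \<subseteq> vectors ?M" by (auto simp: vM \<phi>_def)
      show "\<psi> ` vectors ?M \<subseteq> vectors ?L" by (auto simp: vL \<psi>_def)
    qed
  next
    fix x y show "\<phi> (\<lambda>b. x b + y b) = (\<lambda>d. \<phi> x d + \<phi> y d)"
      by (auto simp: \<phi>_def fun_eq_iff algebra_simps)
  next
    fix f x show "\<phi> (\<lambda>b. f * x b) = (\<lambda>d. f * \<phi> x d)"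
      by (auto simp: \<phi>_def fun_eq_iff algebra_simps)
  next
    fix x y
    have "form ?M (\<phi> x) (\<phi> y) = (\<Sum>k\<in>B2. \<Sum>l\<in>B2. laurent_bar (\<phi> x k) * q_gram b2 k l * \<phi> y l)"
      unfolding free_q_lattice_def by simp
    also have "\<dots> = (\<Sum>i\<in>B1. \<Sum>j\<in>B1. laurent_bar (\<phi> x (\<sigma> i)) * q_gram b2 (\<sigma> i) (\<sigma> j) * \<phi> y (\<sigma> j))"
      by (simp only: sum.reindex_bij_betw[OF \<sigma>, symmetric])
    also have "\<dots> = (\<Sum>i\<in>B1. \<Sum>j\<in>B1. laurent_bar (x i) * q_gram b1 i j * y j)"
    proof (intro sum.cong refl)
      fix i j assume ij: "i \<in> B1" "j \<in> B1"
      have "\<sigma> i = \<sigma> j \<longleftrightarrow> i = j" using \<sigma>B ij by metis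
      then have g: "q_gram b2 (\<sigma> i) (\<sigma> j) = of_int (\<epsilon> i) * of_int (\<epsilon> j) * q_gram b1 i j"
        unfolding q_gram_def using eq[OF ij] \<epsilon>2L[of i 1]
        by (auto simp: algebra_simps simp flip: of_int_mult)
      have "laurent_bar (\<phi> x (\<sigma> i)) = of_int (\<epsilon> i) * laurent_bar (x i)"
        unfolding \<phi>_def using \<sigma>B[OF ij(1)] laurent_bar_sign[OF \<epsilon>] by simp
      moreover have "\<phi> y (\<sigma> j) = of_int (\<epsilon> j) * y j" unfolding \<phi>_def using \<sigma>B[OF ij(2)] by simp
      ultimately have "laurent_bar (\<phi> x (\<sigma> i)) * q_gram b2 (\<sigma> i) (\<sigma> j) * \<phi> y (\<sigma> j) =
        of_int (\<epsilon> i) * (of_int (\<epsilon> i) * (of_int (\<epsilon> j) * (of_int (\<epsilon> j) * (laurent_bar (x i) * q_gram b1 i j * y j))))"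
        unfolding g by (simp only: ac_simps)
      then show "laurent_bar (\<phi> x (\<sigma> i)) * q_gram b2 (\<sigma> i) (\<sigma> j) * \<phi> y (\<sigma> j) = laurent_bar (x i) * q_gram b1 i j * y j"
        by (simp only: \<epsilon>2L)
    qed
    finally show "form ?M (\<phi> x) (\<phi> y) = form ?L x y" unfolding free_q_lattice_def by simp
  qed
  then show "q_lattices_isomorphic ?L ?M" unfolding q_lattices_isomorphic_def by blast
qed

section \<open>Cycles and flows\<close>

lemma undirect_sel [simp]:
  "verts (undirect H) = verts H"
  "arcs (undirect H) = arcs H \<times> UNIV"
  "tail (undirect H) (e, d) = (if d then tail H e else head H e)"
  "head (undirect H) (e, d) = (if d then head H e else tail H e)"
  by (simp_all add: undirect_def)

lemma undirect_ends_arcs_update [simp]: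
  "tail (undirect (G\<lparr>arcs := S\<rparr>)) = tail (undirect G)"
  "head (undirect (G\<lparr>arcs := S\<rparr>)) = head (undirect G)"
  by (auto simp: undirect_def fun_eq_iff)

lemma arcs_ends_undirect:
  "(x, y) \<in> arcs_ends (undirect H) \<longleftrightarrow>
    (\<exists>e\<in>arcs H. tail H e = x \<and> head H e = y \<or> head H e = x \<and> tail H e = y)"
proof
  assume "(x, y) \<in> arcs_ends (undirect H)"
  then show "\<exists>e\<in>arcs H. tail H e = x \<and> head H e = y \<or> head H e = x \<and> tail H e = y"
    unfolding arcs_ends_def arc_to_ends_def by (auto split: if_splits)
next
  assume "\<exists>e\<in>arcs H. tail H e = x \<and> head H e = y \<or> head H e = x \<and> tail H e = y"
  then obtain e where e: "e \<in> arcs H" "tail H e = x \<and> head H e = y \<or> head H e = x \<and> tail H e = y" by blast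
  have "(x, y) = arc_to_ends (undirect H) (e, tail H e = x \<and> head H e = y)"
    using e(2) unfolding arc_to_ends_def by auto
  then show "(x, y) \<in> arcs_ends (undirect H)" unfolding arcs_ends_def using e(1) by auto
qed

lemma (in wf_digraph) wf_digraph_undirect: "S \<subseteq> arcs G \<Longrightarrow> wf_digraph (undirect (G\<lparr>arcs := S\<rparr>))"
  by unfold_locales (auto split: if_splits)

lemma reachable_const:
  assumes "u \<rightarrow>\<^sup>*\<^bsub>H\<^esub> v" "\<And>x y. (x, y) \<in> arcs_ends H \<Longrightarrow> h x = h y"
  shows "h u = h v"
  using assms(1) unfolding reachable_def by (rule rtrancl_on_induct) (use assms(2) in auto)

text \<open>
  Connectedness is used through potentials: a function that is constant along edges is constant.
\<close>

lemma connected_const: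
  assumes "Digraph_Component.connected (G\<lparr>arcs := S\<rparr>)"
    and "\<And>e. e \<in> S \<Longrightarrow> h (tail G e) = h (head G e)" "u \<in> verts G" "v \<in> verts G"
  shows "h u = h v"
proof -
  have "u \<rightarrow>\<^sup>*\<^bsub>with_proj (mk_symmetric (G\<lparr>arcs := S\<rparr>))\<^esub> v"
    using assms(1,3,4) unfolding Digraph_Component.connected_def strongly_connected_def
    by (simp add: mk_symmetric_def)
  then show ?thesis
  proof (rule reachable_const)
    fix x y assume "(x, y) \<in> arcs_ends (with_proj (mk_symmetric (G\<lparr>arcs := S\<rparr>)))"
    then show "h x = h y"
      using assms(2) by (auto simp: mk_symmetric_def arcs_ends_def arc_to_ends_def)
  qed
qed

lemma component_verts_const:
  assumes "w \<in> component_verts G S v" "\<And>e. e \<in> S \<Longrightarrow> h (tail G e) = h (head G e)"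
  shows "h v = h w"
  using assms(1) unfolding component_verts_def mem_Collect_eq
  by (rule reachable_const) (use assms(2) in \<open>fastforce simp: arcs_ends_undirect\<close>)

lemma (in wf_digraph) component_verts_self: "v \<in> verts G \<Longrightarrow> v \<in> component_verts G S v"
  unfolding component_verts_def mem_Collect_eq reachable_def by (rule rtrancl_on_refl) simp

lemma (in wf_digraph) component_verts_edge:
  assumes "S \<subseteq> arcs G" "e \<in> S"
  shows "tail G e \<in> component_verts G S v \<longleftrightarrow> head G e \<in> component_verts G S v"
proof -
  interpret U: wf_digraph "undirect (G\<lparr>arcs := S\<rparr>)" using assms(1) by (rule wf_digraph_undirect)
  have "(tail G e, head G e) \<in> arcs_ends (undirect (G\<lparr>arcs := S\<rparr>))"
    "(head G e, tail G e) \<in> arcs_ends (undirect (G\<lparr>arcs := S\<rparr>))"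
    using assms(2) by (auto simp: arcs_ends_undirect)
  then show ?thesis unfolding component_verts_def mem_Collect_eq by (blast intro: U.reachable_adj_trans)
qed

lemma cas_cong:
  assumes "tail G = tail H" "head G = head H"
  shows "pre_digraph.cas G u p v = pre_digraph.cas H u p v"
  by (induction p arbitrary: u) (simp_all add: pre_digraph.cas.simps assms)

lemma awalk_verts_cong:
  assumes "tail G = tail H" "head G = head H"
  shows "pre_digraph.awalk_verts G u p = pre_digraph.awalk_verts H u p"
  by (simp add: pre_digraph.awalk_verts_conv assms)

lemma undirected_cycle_arcs_update:
  assumes "S \<subseteq> arcs G"
  shows "undirected_cycle (G\<lparr>arcs := S\<rparr>) p \<longleftrightarrow> undirected_cycle G p \<and> fst ` set p \<subseteq> S"
proof -
  have "set p \<subseteq> S \<times> UNIV \<longleftrightarrow> set p \<subseteq> arcs G \<times> UNIV \<and> fst ` set p \<subseteq> S" using assms by force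
  then show ?thesis
    unfolding undirected_cycle_def pre_digraph.cycle_def pre_digraph.awalk_def
    by (auto simp: cas_cong[of "undirect (G\<lparr>arcs := S\<rparr>)" "undirect G"]
        awalk_verts_cong[of "undirect (G\<lparr>arcs := S\<rparr>)" "undirect G"])
qed

lemma (in wf_digraph) apath_undirect_distinct_edges:
  assumes "S \<subseteq> arcs G" "pre_digraph.apath (undirect (G\<lparr>arcs := S\<rparr>)) u p w"
  shows "distinct (map fst p)"
proof -
  interpret U: wf_digraph "undirect (G\<lparr>arcs := S\<rparr>)" using assms(1) by (rule wf_digraph_undirect)
  show ?thesis using assms(2)
  proof (induction p arbitrary: u)
    case (Cons a p)
    have ap: "U.apath (head (undirect G) a) p w"
      and notin: "tail (undirect G) a \<notin> set (U.awalk_verts (head (undirect G) a) p)"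
      using Cons.prems unfolding U.apath_Cons_iff undirect_ends_arcs_update by blast+
    have aw: "U.awalk (head (undirect G) a) p w" using ap by (rule U.awalkI_apath)
    have "fst a \<notin> fst ` set p"
    proof
      assume "fst a \<in> fst ` set p"
      then obtain b where b: "b \<in> set p" "fst b = fst a" by force
      have "tail (undirect G) b \<in> set (U.awalk_verts (head (undirect G) a) p)"
        "head (undirect G) b \<in> set (U.awalk_verts (head (undirect G) a) p)"
        using U.awalk_verts_arc1[OF b(1)] U.awalk_verts_arc2[OF aw b(1)] by simp_all
      moreover have "tail (undirect G) a = tail (undirect G) b \<or> tail (undirect G) a = head (undirect G) b"
        using b(2) by (cases a; cases b) auto
      ultimately show False using notin by metis
    qed
    then show ?case using Cons.IH[OF ap] by simp
  qed simp
qed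

lemma (in wf_digraph) cycle_through_edge:
  assumes S: "S \<subseteq> arcs G" and e: "e \<in> arcs G" "e \<notin> S"
    and reach: "tail G e \<in> component_verts G S (head G e)"
  obtains p where "undirected_cycle (G\<lparr>arcs := insert e S\<rparr>) p" "(e, True) \<in> set p"
proof -
  let ?U = "undirect (G\<lparr>arcs := S\<rparr>)" and ?W = "undirect (G\<lparr>arcs := insert e S\<rparr>)"
  interpret U: wf_digraph ?U using S by (rule wf_digraph_undirect)
  interpret W: wf_digraph ?W using S e by (intro wf_digraph_undirect) simp
  obtain p where p: "U.apath (head G e) p (tail G e)"
    using reach unfolding component_verts_def mem_Collect_eq U.reachable_apath by blast
  have aw: "U.awalk (head G e) p (tail G e)" using p by (rule U.awalkI_apath)
  have sub: "set p \<subseteq> S \<times> UNIV" using aw unfolding U.awalk_def by simp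
  have "W.awalk (head G e) p (tail G e)"
    using aw unfolding U.awalk_def W.awalk_def by (auto simp: cas_cong[of ?W ?U])
  then have "W.awalk (tail G e) ((e, True) # p) (tail G e)"
    unfolding W.awalk_Cons_iff by simp
  moreover have "distinct (tl (W.awalk_verts (tail G e) ((e, True) # p)))"
    using p unfolding U.apath_def by (simp add: awalk_verts_cong[of ?W ?U])
  ultimately have "W.cycle ((e, True) # p)" unfolding W.cycle_def by blast
  moreover have "distinct (map fst ((e, True) # p))"
    using apath_undirect_distinct_edges[OF S p] sub e(2) by auto
  ultimately show ?thesis using that unfolding undirected_cycle_def by (metis list.set_intros(1))
qed

text \<open>
  Kirchhoff's law in integrated form: orthogonality to all coboundaries \<open>h (head e) - h (tail e)\<close>.
  Testing with the indicator of a vertex set gives conservation across the corresponding cut.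
\<close>

definition is_flow :: "('a, 'b) pre_digraph \<Rightarrow> ('b \<Rightarrow> int) \<Rightarrow> bool" where
  "is_flow G x \<longleftrightarrow> (\<forall>e. e \<notin> arcs G \<longrightarrow> x e = 0) \<and>
    (\<forall>h :: 'a \<Rightarrow> int. (\<Sum>e\<in>arcs G. x e * (h (head G e) - h (tail G e))) = 0)"

abbreviation supp :: "('b \<Rightarrow> int) \<Rightarrow> 'b set" where "supp x \<equiv> {e. x e \<noteq> 0}"

text \<open>
  A dart is an edge with a direction of traversal, an arc of the undirected graph.
\<close>

definition dart_sign :: "'b \<times> bool \<Rightarrow> int" where "dart_sign a = (if snd a then 1 else -1)"

context fin_digraph
begin

text \<open>
  In a closed walk the list of tails is a rotation of the list of heads, so distinctness passes
  from one to the other.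
\<close>

lemma cycle_walk:
  assumes "undirected_cycle G p"
  obtains u where "p \<noteq> []" "set p \<subseteq> arcs G \<times> UNIV" "pre_digraph.cas (undirect G) u p u"
    "map (tail (undirect G)) p @ [u] = u # map (head (undirect G)) p"
    "distinct (map (head (undirect G)) p)" "distinct (map (tail (undirect G)) p)"
proof -
  interpret U: wf_digraph "undirect G" using wf_digraph_undirect[of "arcs G"] by simp
  obtain u where u: "U.awalk u p u" "distinct (tl (U.awalk_verts u p))" "p \<noteq> []"
    using assms unfolding undirected_cycle_def U.cycle_def by blast
  have cas: "U.cas u p u" using u(1) unfolding U.awalk_def by simp
  have hd: "tail (undirect G) (hd p) = u" using cas u(3) by (simp add: U.cas_simp)
  have 1: "U.awalk_verts u p = u # map (head (undirect G)) p"
    using U.awalk_verts_conv'[OF cas] u(3) hd by simp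
  have "head (undirect G) (last p) = u"
    using U.awlast_if_cas[OF cas] u(3) by (simp add: U.awalk_verts_conv)
  then have 2: "U.awalk_verts u p = map (tail (undirect G)) p @ [u]"
    using u(3) by (simp add: U.awalk_verts_conv)
  have eq: "map (tail (undirect G)) p @ [u] = u # map (head (undirect G)) p" using 1 2 by simp
  have dh: "distinct (map (head (undirect G)) p)" using u(2) 1 by simp
  have "set (map (tail (undirect G)) p) = set (map (head (undirect G)) p)"
  proof -
    have "u \<in> set (map (tail (undirect G)) p)" using hd u(3) by (metis hd_in_set image_eqI set_map)
    moreover have "u \<in> set (map (head (undirect G)) p)"
      using \<open>head (undirect G) (last p) = u\<close> u(3) by (metis last_in_set image_eqI set_map)
    moreover have "insert u (set (map (tail (undirect G)) p)) = insert u (set (map (head (undirect G)) p))"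
      using arg_cong[OF eq, of set] by simp
    ultimately show ?thesis by (simp only: insert_absorb)
  qed
  then have "distinct (map (tail (undirect G)) p)"
    using dh by (metis card_distinct distinct_card length_map)
  moreover have "set p \<subseteq> arcs G \<times> UNIV" using u(1) unfolding U.awalk_def by simp
  ultimately show ?thesis using that u(3) cas eq dh by blast
qed

lemma sum_over_cycle:
  assumes p: "undirected_cycle G p" and g: "\<And>e. e \<notin> fst ` set p \<Longrightarrow> g e = 0"
  shows "(\<Sum>e\<in>arcs G. g e) = (\<Sum>a\<in>set p. g (fst a) :: int)"
proof -
  have inj: "inj_on fst (set p)" using p unfolding undirected_cycle_def distinct_map by blast
  obtain u where "set p \<subseteq> arcs G \<times> UNIV" using cycle_walk[OF p] by blast
  then have "fst ` set p \<subseteq> arcs G" by auto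
  then have "(\<Sum>e\<in>arcs G. g e) = (\<Sum>e\<in>fst ` set p. g e)"
    using g by (intro sum.mono_neutral_right) auto
  also have "\<dots> = (\<Sum>a\<in>set p. g (fst a))" using sum.reindex[OF inj, of g] by simp
  finally show ?thesis .
qed

lemma signed_edge_sum_dart:
  assumes "distinct (map fst p)" "a \<in> set p"
  shows "signed_edge_sum p (fst a) = dart_sign a"
proof -
  obtain e d where a: "a = (e, d)" by (cases a)
  have "(e, \<not> d) \<notin> set p"
  proof
    assume "(e, \<not> d) \<in> set p"
    then have "(e, \<not> d) = (e, d)" using assms a unfolding distinct_map inj_on_def by force
    then show False by simp
  qed
  then show ?thesis using assms(2) unfolding a signed_edge_sum_def dart_sign_def by (cases d) auto
qed

lemma signed_edge_sum_outside: "e \<notin> fst ` set p \<Longrightarrow> signed_edge_sum p e = 0"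
  unfolding signed_edge_sum_def by force

lemma dart_difference:
  "dart_sign a * (h (head G (fst a)) - h (tail G (fst a))) =
    (h (head (undirect G) a) - h (tail (undirect G) a) :: int)"
  by (cases a) (simp add: dart_sign_def)

lemma cas_telescope:
  "pre_digraph.cas (undirect G) u p v \<Longrightarrow>
    (\<Sum>a\<leftarrow>p. h (head (undirect G) a) - h (tail (undirect G) a)) = h v - (h u :: int)"
  by (induction p arbitrary: u) (auto simp: pre_digraph.cas.simps)

lemma cycle_is_flow:
  assumes p: "undirected_cycle G p"
  shows "is_flow G (signed_edge_sum p)" "supp (signed_edge_sum p) = fst ` set p"
    "p \<noteq> []"
proof -
  obtain u where u: "p \<noteq> []" "set p \<subseteq> arcs G \<times> UNIV" "pre_digraph.cas (undirect G) u p u"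
    using cycle_walk[OF p] by blast
  have d: "distinct (map fst p)" using p unfolding undirected_cycle_def by blast
  have sub: "fst ` set p \<subseteq> arcs G" using u(2) by auto
  show "p \<noteq> []" by fact
  show "supp (signed_edge_sum p) = fst ` set p"
  proof (intro equalityI subsetI)
    fix e assume "e \<in> supp (signed_edge_sum p)"
    then show "e \<in> fst ` set p" using signed_edge_sum_outside[of e p] by blast
  next
    fix e assume "e \<in> fst ` set p"
    then obtain a where "a \<in> set p" "e = fst a" by blast
    then show "e \<in> supp (signed_edge_sum p)"
      using signed_edge_sum_dart[OF d] by (simp add: dart_sign_def)
  qed
  show "is_flow G (signed_edge_sum p)"
    unfolding is_flow_def
  proof (intro conjI allI impI)
    fix e assume "e \<notin> arcs G"
    then have "e \<notin> fst ` set p" using sub by blast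
    then show "signed_edge_sum p e = 0" by (rule signed_edge_sum_outside)
  next
    fix h :: "'a \<Rightarrow> int"
    have "(\<Sum>e\<in>arcs G. signed_edge_sum p e * (h (head G e) - h (tail G e))) =
      (\<Sum>a\<in>set p. signed_edge_sum p (fst a) * (h (head G (fst a)) - h (tail G (fst a))))"
      using signed_edge_sum_outside by (intro sum_over_cycle[OF p]) auto
    also have "\<dots> = (\<Sum>a\<in>set p. h (head (undirect G) a) - h (tail (undirect G) a))"
      by (intro sum.cong refl) (simp add: signed_edge_sum_dart[OF d] dart_difference)
    also have "\<dots> = (\<Sum>a\<leftarrow>p. h (head (undirect G) a) - h (tail (undirect G) a))"
      using d by (intro sum_list_distinct_conv_sum_set[symmetric]) (simp add: distinct_map)
    also have "\<dots> = 0" using cas_telescope[OF u(3)] by simp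
    finally show "(\<Sum>e\<in>arcs G. signed_edge_sum p e * (h (head G e) - h (tail G e))) = 0" .
  qed
qed

text \<open>
  The indicator of the vertex between two consecutive edges of the cycle shows that a flow supported on
  the cycle has the same value on both, up to orientation; so it vanishes nowhere on the
  cycle or everywhere.
\<close>

lemma flow_on_cycle:
  assumes p: "undirected_cycle G p" and y: "is_flow G y" "supp y \<subseteq> fst ` set p" "supp y \<noteq> {}"
  shows "supp y = fst ` set p"
proof -
  obtain u where u: "p \<noteq> []"
    "map (tail (undirect G)) p @ [u] = u # map (head (undirect G)) p"
    "distinct (map (head (undirect G)) p)" "distinct (map (tail (undirect G)) p)"
    using cycle_walk[OF p] by blast
  \<comment> \<open>the flow through a dart in the direction of the walk\<close>
  define w where "w a = dart_sign a * y (fst a)" for a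
  have d: "distinct p" using u(3) by (simp add: distinct_map)
  have next_eq: "w (p ! Suc i) = w (p ! i)" if i: "Suc i < length p" for i
  proof -
    define v where "v = head (undirect G) (p ! i)"
    have v: "v = tail (undirect G) (p ! Suc i)"
    proof -
      have "(map (tail (undirect G)) p @ [u]) ! Suc i = (u # map (head (undirect G)) p) ! Suc i" using u(2) by simp
      then show ?thesis using i by (simp add: nth_append v_def)
    qed
    define h where "h = (\<lambda>x. of_bool (x = v) :: int)"
    have "0 = (\<Sum>e\<in>arcs G. y e * (h (head G e) - h (tail G e)))" using y(1) unfolding is_flow_def by simp
    also have "\<dots> = (\<Sum>a\<in>set p. y (fst a) * (h (head G (fst a)) - h (tail G (fst a))))"
      using y(2) by (intro sum_over_cycle[OF p]) auto
    also have "\<dots> = (\<Sum>a\<in>set p. w a * h (head (undirect G) a) - w a * h (tail (undirect G) a))"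
    proof (intro sum.cong refl)
      fix a
      have "w a * h (head (undirect G) a) - w a * h (tail (undirect G) a) =
        (dart_sign a * dart_sign a) * (y (fst a) * (h (head G (fst a)) - h (tail G (fst a))))"
        unfolding w_def right_diff_distrib[symmetric] dart_difference[of a h, symmetric] by (simp only: ac_simps)
      then show "y (fst a) * (h (head G (fst a)) - h (tail G (fst a))) =
        w a * h (head (undirect G) a) - w a * h (tail (undirect G) a)"
        by (simp add: dart_sign_def)
    qed
    also have "\<dots> = (\<Sum>a\<in>set p. w a * h (head (undirect G) a)) - (\<Sum>a\<in>set p. w a * h (tail (undirect G) a))"
      by (rule sum_subtractf)
    also have "(\<Sum>a\<in>set p. w a * h (head (undirect G) a)) = (\<Sum>a\<in>{p ! i}. w a * h (head (undirect G) a))"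
    proof (intro sum.mono_neutral_right)
      show "\<forall>a\<in>set p - {p ! i}. w a * h (head (undirect G) a) = 0"
      proof
        fix a assume a: "a \<in> set p - {p ! i}"
        have "inj_on (head (undirect G)) (set p)" using u(3) unfolding distinct_map by blast
        then have "head (undirect G) a \<noteq> head (undirect G) (p ! i)"
          using a i by (auto dest!: inj_onD[where x = a and y = "p ! i"])
        then show "w a * h (head (undirect G) a) = 0" by (simp add: h_def v_def)
      qed
    qed (use i in auto)
    also have "\<dots> = w (p ! i)" by (simp add: h_def v_def)
    also have "(\<Sum>a\<in>set p. w a * h (tail (undirect G) a)) = (\<Sum>a\<in>{p ! Suc i}. w a * h (tail (undirect G) a))"
    proof (intro sum.mono_neutral_right)
      show "\<forall>a\<in>set p - {p ! Suc i}. w a * h (tail (undirect G) a) = 0"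
      proof
        fix a assume a: "a \<in> set p - {p ! Suc i}"
        have "inj_on (tail (undirect G)) (set p)" using u(4) unfolding distinct_map by blast
        then have "tail (undirect G) a \<noteq> tail (undirect G) (p ! Suc i)"
          using a i by (auto dest!: inj_onD[where x = a and y = "p ! Suc i"])
        then show "w a * h (tail (undirect G) a) = 0" by (simp add: h_def v)
      qed
    qed (use i in auto)
    also have "\<dots> = w (p ! Suc i)" by (simp add: h_def v)
    finally show ?thesis by simp
  qed
  have const: "w (p ! i) = w (p ! 0)" if "i < length p" for i
    using that by (induction i) (use next_eq in auto)
  have w0: "w a \<noteq> 0 \<longleftrightarrow> y (fst a) \<noteq> 0" for a by (simp add: w_def dart_sign_def)
  obtain e where "e \<in> supp y" using y(3) by blast
  then obtain a where a: "a \<in> set p" "y (fst a) \<noteq> 0" using y(2) by auto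
  then have "w (p ! 0) \<noteq> 0" using const w0 by (metis in_set_conv_nth)
  then have "y (fst b) \<noteq> 0" if "b \<in> set p" for b using that const w0 by (metis in_set_conv_nth)
  then show ?thesis using y(2) by auto
qed

lemma cycle_edge_set_flow:
  assumes "cycle_edge_set G S"
  obtains x where "is_flow G x" "supp x = S" "S \<noteq> {}"
proof -
  obtain p where p: "undirected_cycle G p" "S = fst ` set p" using assms unfolding cycle_edge_set_def by blast
  show ?thesis using that[of "signed_edge_sum p"] cycle_is_flow[OF p(1)] p(2) by simp
qed

lemma cycle_edge_set_minimal:
  assumes "cycle_edge_set G S" "is_flow G y" "supp y \<subseteq> S" "supp y \<noteq> {}"
  shows "supp y = S"
  using assms flow_on_cycle unfolding cycle_edge_set_def by metis

text \<open>
  If \<open>e\<close> did not close up to a cycle in the support, the component of its head in the rest of the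
  support would define a cut that the flow crosses in \<open>e\<close> alone.
\<close>

lemma flow_contains_cycle:
  assumes x: "is_flow G x" and e: "x e \<noteq> 0"
  obtains S where "cycle_edge_set G S" "e \<in> S" "S \<subseteq> supp x"
proof -
  let ?S = "supp x - {e}"
  have sub: "supp x \<subseteq> arcs G" using x unfolding is_flow_def by auto
  then have S: "?S \<subseteq> arcs G" and eG: "e \<in> arcs G" using e by auto
  have "tail G e \<in> component_verts G ?S (head G e)"
  proof (rule ccontr)
    assume n: "\<not> ?thesis"
    define h where "h v = (of_bool (v \<in> component_verts G ?S (head G e)) :: int)" for v
    have "(\<Sum>f\<in>arcs G. x f * (h (head G f) - h (tail G f))) = (\<Sum>f\<in>{e}. x f * (h (head G f) - h (tail G f)))"
    proof (intro sum.mono_neutral_right ballI)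
      fix f assume f: "f \<in> arcs G - {e}"
      show "x f * (h (head G f) - h (tail G f)) = 0"
      proof (cases "x f = 0")
        case False
        then have "f \<in> ?S" using f by simp
        then show ?thesis using component_verts_edge[OF S] unfolding h_def by simp
      qed simp
    qed (use eG in auto)
    also have "\<dots> = x e" using n component_verts_self[of "head G e" ?S] eG by (simp add: h_def)
    finally show False using x e unfolding is_flow_def by simp
  qed
  then obtain p where p: "undirected_cycle (G\<lparr>arcs := insert e ?S\<rparr>) p" "(e, True) \<in> set p"
    using cycle_through_edge[OF S eG] by blast
  have "insert e ?S = supp x" using e by auto
  then have "undirected_cycle G p" "fst ` set p \<subseteq> supp x"
    using p(1) undirected_cycle_arcs_update[OF sub] by auto
  moreover have "e \<in> fst ` set p" using p(2) by force
  ultimately show ?thesis using that unfolding cycle_edge_set_def by blast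
qed

end

section \<open>Fundamental cycles and cuts\<close>

locale tree_in_graph = fin_digraph G + loopfree_digraph G
  for G :: "('a, 'b) pre_digraph" (structure) +
  fixes T :: "'b set"
  assumes tree: "spanning_tree_edges G T" and two_edge_connected: "two_edge_connected G"
begin

definition cotree :: "'b set" where "cotree = arcs G - T"

definition coeff :: "'b \<Rightarrow> 'b \<Rightarrow> int" where "coeff i j = fund_cycle G T j i"

definition side :: "'b \<Rightarrow> 'a \<Rightarrow> int" where
  "side i v = of_bool (v \<in> component_verts G (T - {i}) (head G i))"

lemma T_arcs: "T \<subseteq> arcs G" and T_connected: "Digraph_Component.connected (G\<lparr>arcs := T\<rparr>)"
  and T_acyclic: "\<not> undirected_cycle (G\<lparr>arcs := T\<rparr>) p"
  using tree unfolding spanning_tree_edges_def by blast+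

lemma finite_T: "finite T" and finite_cotree: "finite cotree"
  using finite_subset[OF T_arcs finite_arcs] unfolding cotree_def by auto

lemma arcs_split: "arcs G = T \<union> cotree" "T \<inter> cotree = {}"
  using T_arcs unfolding cotree_def by auto

lemma side_head: "i \<in> T \<Longrightarrow> side i (head G i) = 1"
  using T_arcs component_verts_self[of "head G i" "T - {i}"] unfolding side_def by auto

lemma side_tail:
  assumes "i \<in> T"
  shows "side i (tail G i) = 0"
proof (rule ccontr)
  assume "side i (tail G i) \<noteq> 0"
  then have "tail G i \<in> component_verts G (T - {i}) (head G i)" unfolding side_def by (simp split: if_splits)
  then obtain p where "undirected_cycle (G\<lparr>arcs := insert i (T - {i})\<rparr>) p"
    using cycle_through_edge[of "T - {i}" i] T_arcs assms by blast
  then show False using T_acyclic assms by (simp add: insert_absorb)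
qed

lemma side_tree_edge:
  assumes "t \<in> T" "t \<noteq> i"
  shows "side i (tail G t) = side i (head G t)"
  unfolding side_def using component_verts_edge[of "T - {i}" t] T_arcs assms by auto

text \<open>
  The two components of \<open>T - {i}\<close> partition the vertices, so the fundamental cut is the
  coboundary of the indicator of one of them.
\<close>

lemma fund_cut_side:
  assumes i: "i \<in> T" and e: "e \<in> arcs G"
  shows "fund_cut G T i e = side i (head G e) - side i (tail G e)"
proof -
  let ?V0 = "component_verts G (T - {i}) (tail G i)" and ?V1 = "component_verts G (T - {i}) (head G i)"
  have "w \<notin> ?V1" if "w \<in> ?V0" for w
  proof -
    have "side i (tail G i) = side i w"
      by (rule component_verts_const[OF that]) (use side_tree_edge in auto)
    then show ?thesis using side_tail[OF i] unfolding side_def by simp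
  qed
  moreover have "w \<in> ?V0 \<union> ?V1" if w: "w \<in> verts G" for w
  proof -
    have self: "tail G i \<in> ?V0" "head G i \<in> ?V1" using i T_arcs component_verts_self by (simp_all add: subset_iff)
    have "(w \<in> ?V0 \<union> ?V1) = (head G i \<in> ?V0 \<union> ?V1)"
    proof (rule connected_const[OF T_connected, where h = "\<lambda>w. w \<in> ?V0 \<union> ?V1"])
      fix t assume t: "t \<in> T"
      show "(tail G t \<in> ?V0 \<union> ?V1) = (head G t \<in> ?V0 \<union> ?V1)"
      proof (cases "t = i")
        case True then show ?thesis using self by blast
      next
        case False
        then show ?thesis using component_verts_edge[of "T - {i}" t] T_arcs t by blast
      qed
    qed (use w i T_arcs in auto)
    then show ?thesis using self by blast
  qed
  ultimately have V0: "w \<in> ?V0 \<longleftrightarrow> w \<notin> ?V1" if "w \<in> verts G" for w using that by blast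
  show ?thesis
    unfolding fund_cut_def Let_def side_def using e V0[of "tail G e"] V0[of "head G e"] by simp
qed

lemma fund_cut_self: "i \<in> T \<Longrightarrow> fund_cut G T i i = 1"
  using fund_cut_side[of i i] side_head side_tail T_arcs by auto

lemma fund_cut_tree_edge: "i \<in> T \<Longrightarrow> t \<in> T \<Longrightarrow> t \<noteq> i \<Longrightarrow> fund_cut G T i t = 0"
  using fund_cut_side[of i t] side_tree_edge T_arcs by auto

text \<open>
  Conservation across the fundamental cut of \<open>i\<close>, which meets \<open>T\<close> in \<open>i\<close> only.
\<close>

lemma flow_on_tree_edge:
  assumes y: "is_flow G y" and i: "i \<in> T"
  shows "y i = - (\<Sum>j\<in>cotree. y j * fund_cut G T i j)"
proof -
  have "0 = (\<Sum>e\<in>arcs G. y e * (side i (head G e) - side i (tail G e)))"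
    using y unfolding is_flow_def by simp
  also have "\<dots> = (\<Sum>e\<in>arcs G. y e * fund_cut G T i e)"
    using fund_cut_side[OF i] by (intro sum.cong) auto
  also have "\<dots> = (\<Sum>e\<in>T. y e * fund_cut G T i e) + (\<Sum>e\<in>cotree. y e * fund_cut G T i e)"
    unfolding arcs_split(1) using finite_T finite_cotree arcs_split(2) by (rule sum.union_disjoint)
  also have "(\<Sum>e\<in>T. y e * fund_cut G T i e) = (\<Sum>e\<in>{i}. y e * fund_cut G T i e)"
    using finite_T i fund_cut_tree_edge[OF i] by (intro sum.mono_neutral_right) auto
  finally show ?thesis using fund_cut_self[OF i] by simp
qed

text \<open>
  A flow is determined by its values off the tree, so all cycles in \<open>insert j T\<close> that traverse \<open>j\<close> along its
  orientation have the same vector, and the definite description denotes it.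
\<close>

lemma fund_cycle_walk:
  assumes j: "j \<in> cotree"
  obtains p where "undirected_cycle G p" "fund_cycle G T j = signed_edge_sum p"
    "(j, True) \<in> set p" "fst ` set p \<subseteq> insert j T"
proof -
  have jG: "j \<in> arcs G" "j \<notin> T" using j unfolding cotree_def by auto
  have sub: "insert j T \<subseteq> arcs G" using jG T_arcs by auto
  have "(tail G j \<in> component_verts G T (head G j)) = (head G j \<in> component_verts G T (head G j))"
    by (rule connected_const[OF T_connected, where h = "\<lambda>v. v \<in> component_verts G T (head G j)"])
      (use component_verts_edge[OF T_arcs] jG in auto)
  then have "tail G j \<in> component_verts G T (head G j)" using component_verts_self jG by simp
  then obtain p where p: "undirected_cycle (G\<lparr>arcs := insert j T\<rparr>) p" "(j, True) \<in> set p"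
    using cycle_through_edge[OF T_arcs jG] by blast
  have det: "signed_edge_sum q = (\<lambda>e. if e = j then 1 else if e \<in> T then - fund_cut G T e j else 0)"
    if q: "undirected_cycle (G\<lparr>arcs := insert j T\<rparr>) q" "(j, True) \<in> set q" for q
  proof
    fix e
    have q': "undirected_cycle G q" "fst ` set q \<subseteq> insert j T"
      using q(1) undirected_cycle_arcs_update[OF sub] by auto
    have out: "signed_edge_sum q f = 0" if "f \<notin> insert j T" for f
      using that q'(2) by (intro signed_edge_sum_outside) blast
    have "distinct (map fst q)" using q'(1) unfolding undirected_cycle_def by blast
    from signed_edge_sum_dart[OF this q(2)]
    have one: "signed_edge_sum q j = 1" by (simp add: dart_sign_def)
    have "signed_edge_sum q e = - fund_cut G T e j" if e: "e \<in> T"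
    proof -
      have "(\<Sum>f\<in>cotree. signed_edge_sum q f * fund_cut G T e f) =
        (\<Sum>f\<in>{j}. signed_edge_sum q f * fund_cut G T e f)"
        using finite_cotree j out arcs_split(2) by (intro sum.mono_neutral_right) auto
      then show ?thesis using flow_on_tree_edge[OF cycle_is_flow(1)[OF q'(1)] e] one by simp
    qed
    then show "signed_edge_sum q e = (if e = j then 1 else if e \<in> T then - fund_cut G T e j else 0)"
      using one out by auto
  qed
  have "fund_cycle G T j = signed_edge_sum p"
    unfolding fund_cycle_def
  proof (rule the_equality)
    show "\<exists>q. undirected_cycle (G\<lparr>arcs := insert j T\<rparr>) q \<and> (j, True) \<in> set q \<and> signed_edge_sum p = signed_edge_sum q"
      using p by blast
  next
    fix x assume "\<exists>q. undirected_cycle (G\<lparr>arcs := insert j T\<rparr>) q \<and> (j, True) \<in> set q \<and> x = signed_edge_sum q"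
    then show "x = signed_edge_sum p" using det p by auto
  qed
  then show ?thesis using that p undirected_cycle_arcs_update[OF sub] by blast
qed

lemma fund_cycle_props:
  assumes j: "j \<in> cotree"
  shows "is_flow G (fund_cycle G T j)" "fund_cycle G T j j = 1"
    "e \<notin> insert j T \<Longrightarrow> fund_cycle G T j e = 0"
    "cycle_edge_set G (supp (fund_cycle G T j))"
proof -
  obtain p where p: "undirected_cycle G p" "fund_cycle G T j = signed_edge_sum p"
    "(j, True) \<in> set p" "fst ` set p \<subseteq> insert j T"
    using fund_cycle_walk[OF j] by blast
  show "is_flow G (fund_cycle G T j)" using cycle_is_flow(1)[OF p(1)] p(2) by simp
  have "distinct (map fst p)" using p(1) unfolding undirected_cycle_def by blast
  from signed_edge_sum_dart[OF this p(3)] show "fund_cycle G T j j = 1"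
    using p(2) by (simp add: dart_sign_def)
  show "fund_cycle G T j e = 0" if "e \<notin> insert j T"
    unfolding p(2) using that p(4) by (intro signed_edge_sum_outside) blast
  show "cycle_edge_set G (supp (fund_cycle G T j))"
    unfolding cycle_edge_set_def p(2) cycle_is_flow(2)[OF p(1)] using p(1) by blast
qed

lemma fund_cycle_outside: "j \<in> cotree \<Longrightarrow> k \<in> cotree \<Longrightarrow> k \<noteq> j \<Longrightarrow> fund_cycle G T j k = 0"
  using fund_cycle_props(3)[of j k] arcs_split(2) by auto

text \<open>
  Orthogonality of cycles and cuts: the same matrix, up to sign, describes the fundamental cuts.
\<close>

lemma fund_cut_coeff:
  assumes i: "i \<in> T" and j: "j \<in> cotree"
  shows "fund_cut G T i j = - coeff i j"
proof -
  have "(\<Sum>f\<in>cotree. fund_cycle G T j f * fund_cut G T i f) = (\<Sum>f\<in>{j}. fund_cycle G T j f * fund_cut G T i f)"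
    using finite_cotree j fund_cycle_outside[OF j] by (intro sum.mono_neutral_right) auto
  then show ?thesis
    using flow_on_tree_edge[OF fund_cycle_props(1)[OF j] i] fund_cycle_props(2)[OF j] unfolding coeff_def by simp
qed

lemma flow_iff:
  "is_flow G y \<longleftrightarrow> (\<forall>e. e \<notin> arcs G \<longrightarrow> y e = 0) \<and> (\<forall>i\<in>T. y i = (\<Sum>j\<in>cotree. y j * coeff i j))"
proof (intro iffI conjI)
  assume y: "is_flow G y"
  then show "\<forall>e. e \<notin> arcs G \<longrightarrow> y e = 0" unfolding is_flow_def by blast
  show "\<forall>i\<in>T. y i = (\<Sum>j\<in>cotree. y j * coeff i j)"
    using flow_on_tree_edge[OF y] fund_cut_coeff by (simp add: sum_negf)
next
  assume y: "(\<forall>e. e \<notin> arcs G \<longrightarrow> y e = 0) \<and> (\<forall>i\<in>T. y i = (\<Sum>j\<in>cotree. y j * coeff i j))"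
  have comb: "y e = (\<Sum>j\<in>cotree. y j * fund_cycle G T j e)" if e: "e \<in> arcs G" for e
  proof (cases "e \<in> T")
    case True
    then show ?thesis using y unfolding coeff_def by blast
  next
    case False
    then have ec: "e \<in> cotree" using e unfolding cotree_def by blast
    have "(\<Sum>j\<in>cotree. y j * fund_cycle G T j e) = (\<Sum>j\<in>{e}. y j * fund_cycle G T j e)"
      using finite_cotree ec fund_cycle_outside[OF _ ec] by (intro sum.mono_neutral_right) auto
    then show ?thesis using fund_cycle_props(2)[OF ec] by simp
  qed
  have "(\<Sum>e\<in>arcs G. y e * (h (head G e) - h (tail G e))) = 0" for h :: "'a \<Rightarrow> int"
  proof -
    have "(\<Sum>e\<in>arcs G. y e * (h (head G e) - h (tail G e))) =
      (\<Sum>e\<in>arcs G. \<Sum>j\<in>cotree. y j * (fund_cycle G T j e * (h (head G e) - h (tail G e))))"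
    proof (rule sum.cong[OF refl])
      fix e assume e: "e \<in> arcs G"
      show "y e * (h (head G e) - h (tail G e)) =
        (\<Sum>j\<in>cotree. y j * (fund_cycle G T j e * (h (head G e) - h (tail G e))))"
        by (subst comb[OF e]) (simp add: sum_distrib_right mult.assoc)
    qed
    also have "\<dots> = (\<Sum>j\<in>cotree. y j * (\<Sum>e\<in>arcs G. fund_cycle G T j e * (h (head G e) - h (tail G e))))"
      unfolding sum_distrib_left by (rule sum.swap)
    also have "\<dots> = 0"
      using fund_cycle_props(1) unfolding is_flow_def by (intro sum.neutral) simp
    finally show ?thesis .
  qed
  then show "is_flow G y" using y unfolding is_flow_def by blast
qed

text \<open>
  For \<open>J \<subseteq> T\<close>, let \<open>h v\<close> be the parity of the number of edges \<open>i \<in> J\<close> such that \<open>v\<close> lies on the head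
  side of \<open>i\<close>. Along a tree edge \<open>h\<close> changes exactly if the edge belongs to \<open>J\<close>, and then by
  \<open>\<plusminus>1\<close>; these changes are the signs. Since the fundamental cycle of \<open>j\<close> is orthogonal to the
  coboundary of \<open>h\<close>, the signed sum of its coefficients on \<open>J\<close> is the change of \<open>h\<close> along \<open>j\<close> with
  opposite sign, and \<open>h\<close> takes only the values \<open>0\<close> and \<open>1\<close>.
\<close>

lemma coeff_equitable: "equitable cotree T (\<lambda>j i. coeff i j)"
  unfolding equitable_def
proof (intro allI impI)
  fix J assume J: "J \<subseteq> T"
  have finJ: "finite J" using J finite_T finite_subset by blast
  define s where "s v = (\<Sum>i\<in>J. side i v)" for v
  define h where "h v = s v mod 2" for v
  have h01: "h v \<in> {0, 1}" for v unfolding h_def by auto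
  have s_T: "s (head G t) = s (tail G t) + of_bool (t \<in> J)" if t: "t \<in> T" for t
  proof -
    have "s (head G t) - s (tail G t) = (\<Sum>i\<in>J. side i (head G t) - side i (tail G t))"
      unfolding s_def by (simp add: sum_subtractf)
    also have "\<dots> = (\<Sum>i\<in>J \<inter> {t}. side i (head G t) - side i (tail G t))"
    proof (rule sum.mono_neutral_right[OF finJ])
      show "\<forall>i\<in>J - J \<inter> {t}. side i (head G t) - side i (tail G t) = 0"
      proof
        fix i assume "i \<in> J - J \<inter> {t}"
        then have "t \<noteq> i" by blast
        then show "side i (head G t) - side i (tail G t) = 0" using side_tree_edge[OF t] by simp
      qed
    qed simp
    also have "\<dots> = of_bool (t \<in> J)" using side_head[OF t] side_tail[OF t] by auto
    finally show ?thesis by simp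
  qed
  have jump: "h (head G t) - h (tail G t) \<in> {-1, 1}" if "t \<in> J" for t
  proof -
    have "s (head G t) = s (tail G t) + 1" using s_T[of t] that J by auto
    moreover have "(x + 1) mod 2 - x mod 2 = - 1 \<or> (x + 1) mod 2 - x mod 2 = 1" for x :: int by presburger
    ultimately show ?thesis unfolding h_def by simp
  qed
  have flat: "h (head G t) - h (tail G t) = 0" if "t \<in> T" "t \<notin> J" for t
    using s_T[of t] that unfolding h_def by simp
  define \<epsilon> where "\<epsilon> t = (if t \<in> J then h (head G t) - h (tail G t) else 1)" for t
  have "(\<Sum>i\<in>J. \<epsilon> i * coeff i j) \<in> {-1, 0, 1}" if j: "j \<in> cotree" for j
  proof -
    let ?C = "fund_cycle G T j"
    have "0 = (\<Sum>e\<in>arcs G. ?C e * (h (head G e) - h (tail G e)))"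
      using fund_cycle_props(1)[OF j] unfolding is_flow_def by simp
    also have "\<dots> = (\<Sum>e\<in>T. ?C e * (h (head G e) - h (tail G e))) +
      (\<Sum>e\<in>cotree. ?C e * (h (head G e) - h (tail G e)))"
      unfolding arcs_split(1) using finite_T finite_cotree arcs_split(2) by (rule sum.union_disjoint)
    also have "(\<Sum>e\<in>T. ?C e * (h (head G e) - h (tail G e))) = (\<Sum>e\<in>J. ?C e * (h (head G e) - h (tail G e)))"
      using finite_T J flat by (intro sum.mono_neutral_right) auto
    also have "\<dots> = (\<Sum>i\<in>J. \<epsilon> i * coeff i j)"
      by (intro sum.cong refl) (simp add: \<epsilon>_def coeff_def)
    also have "(\<Sum>e\<in>cotree. ?C e * (h (head G e) - h (tail G e))) = (\<Sum>e\<in>{j}. ?C e * (h (head G e) - h (tail G e)))"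
      using finite_cotree j fund_cycle_outside[OF j] by (intro sum.mono_neutral_right) auto
    finally have "(\<Sum>i\<in>J. \<epsilon> i * coeff i j) = h (tail G j) - h (head G j)"
      using fund_cycle_props(2)[OF j] by simp
    then show ?thesis using h01[of "tail G j"] h01[of "head G j"] by auto
  qed
  moreover have "\<epsilon> t \<in> {-1, 1}" for t unfolding \<epsilon>_def using jump by auto
  ultimately show "\<exists>\<epsilon>. (\<forall>t. \<epsilon> t \<in> {-1, 1}) \<and> (\<forall>j\<in>cotree. (\<Sum>i\<in>J. \<epsilon> i * coeff i j) \<in> {-1, 0, 1})"
    by blast
qed

text \<open>
  Otherwise the fundamental cycle would be a loop.
\<close>

lemma cotree_edge_meets_tree:
  assumes j: "j \<in> cotree"
  shows "\<exists>i\<in>T. coeff i j \<noteq> 0"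
proof (rule ccontr)
  assume "\<not> ?thesis"
  then have z: "fund_cycle G T j e = 0" if "e \<noteq> j" for e
    using fund_cycle_props(3)[OF j, of e] that unfolding coeff_def by blast
  have jG: "j \<in> arcs G" using j unfolding cotree_def by blast
  define h where "h v = (of_bool (v = head G j) :: int)" for v
  have "0 = (\<Sum>e\<in>arcs G. fund_cycle G T j e * (h (head G e) - h (tail G e)))"
    using fund_cycle_props(1)[OF j] unfolding is_flow_def by simp
  also have "\<dots> = (\<Sum>e\<in>{j}. fund_cycle G T j e * (h (head G e) - h (tail G e)))"
    using jG z by (intro sum.mono_neutral_right) auto
  finally show False
    using fund_cycle_props(2)[OF j] no_loops[OF jG] by (simp add: h_def)
qed

text \<open>
  Otherwise \<open>i\<close> would be the only edge in its fundamental cut, that is, a bridge.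
\<close>

lemma tree_edge_in_cycle:
  assumes i: "i \<in> T"
  shows "\<exists>j\<in>cotree. coeff i j \<noteq> 0"
proof (rule ccontr)
  assume n: "\<not> ?thesis"
  have iG: "i \<in> arcs G" using i T_arcs by blast
  have "del_arc i = G\<lparr>arcs := arcs G - {i}\<rparr>" by (simp add: del_arc_def)
  then have conn: "Digraph_Component.connected (G\<lparr>arcs := arcs G - {i}\<rparr>)"
    using two_edge_connected iG unfolding two_edge_connected_def by metis
  have "side i (tail G i) = side i (head G i)"
  proof (rule connected_const[OF conn])
    fix e assume e: "e \<in> arcs G - {i}"
    show "side i (tail G e) = side i (head G e)"
    proof (cases "e \<in> T")
      case True then show ?thesis using side_tree_edge e by blast
    next
      case False
      then have "e \<in> cotree" using e unfolding cotree_def by blast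
      then have "fund_cut G T i e = 0" using fund_cut_coeff[OF i] n by simp
      then show ?thesis using fund_cut_side[OF i] e by simp
    qed
  qed (use iG in auto)
  then show False using side_head[OF i] side_tail[OF i] by simp
qed

lemma inner_split: "edge_inner G x y = (\<Sum>e\<in>T. x e * y e) + (\<Sum>e\<in>cotree. x e * y e)"
  unfolding edge_inner_def arcs_split(1) using finite_T finite_cotree arcs_split(2) by (rule sum.union_disjoint)

lemma inner_fund_cycle:
  assumes j: "j \<in> cotree" "k \<in> cotree"
  shows "edge_inner G (fund_cycle G T j) (fund_cycle G T k) = of_bool (j = k) + gram T coeff j k"
proof -
  have "(\<Sum>e\<in>cotree. fund_cycle G T j e * fund_cycle G T k e) = (\<Sum>e\<in>{j}. fund_cycle G T j e * fund_cycle G T k e)"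
    using finite_cotree j fund_cycle_outside[OF j(1)] by (intro sum.mono_neutral_right) auto
  also have "\<dots> = of_bool (j = k)"
    using fund_cycle_props(2) fund_cycle_outside j by auto
  finally show ?thesis unfolding inner_split gram_def coeff_def by simp
qed

lemma inner_fund_cut:
  assumes i: "i \<in> T" "k \<in> T"
  shows "edge_inner G (fund_cut G T i) (fund_cut G T k) = of_bool (i = k) + gram cotree (\<lambda>j i. coeff i j) i k"
proof -
  have "(\<Sum>e\<in>T. fund_cut G T i e * fund_cut G T k e) = (\<Sum>e\<in>{i}. fund_cut G T i e * fund_cut G T k e)"
    using finite_T i fund_cut_tree_edge[OF i(1)] by (intro sum.mono_neutral_right) auto
  also have "\<dots> = of_bool (i = k)"
    using fund_cut_self fund_cut_tree_edge i by auto
  finally show ?thesis unfolding inner_split gram_def using fund_cut_coeff i by simp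
qed

end

lemma free_q_lattice_cong:
  "(\<And>i j. i \<in> B \<Longrightarrow> j \<in> B \<Longrightarrow> A i j = A' i j) \<Longrightarrow> free_q_lattice B A = free_q_lattice B A'"
  unfolding free_q_lattice_def by (simp cong: sum.cong)

section \<open>The coefficient matrix as a complete invariant\<close>

context tree_in_graph
begin

lemma q_flow_lattice_gram:
  "q_flow_lattice G T = free_q_lattice cotree (q_gram (gram T coeff))"
  unfolding q_flow_lattice_def cotree_def[symmetric]
proof (rule free_q_lattice_cong)
  fix i j assume "i \<in> cotree" "j \<in> cotree"
  then show "(if i = j then 1 + of_int (edge_inner G (fund_cycle G T j) (fund_cycle G T j) - 1) * laurent_q ^ 2
      else of_int (edge_inner G (fund_cycle G T i) (fund_cycle G T j)) * laurent_q ^ 2) =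
    q_gram (gram T coeff) i j"
    by (simp add: q_gram_def inner_fund_cycle)
qed

lemma q_cut_lattice_gram:
  "q_cut_lattice G T = free_q_lattice T (q_gram (gram cotree (\<lambda>j i. coeff i j)))"
  unfolding q_cut_lattice_def
proof (rule free_q_lattice_cong)
  fix i j assume "i \<in> T" "j \<in> T"
  then show "(if i = j then 1 + of_int (edge_inner G (fund_cut G T j) (fund_cut G T j) - 1) * laurent_q ^ 2
      else of_int (edge_inner G (fund_cut G T i) (fund_cut G T j)) * laurent_q ^ 2) =
    q_gram (gram cotree (\<lambda>j i. coeff i j)) i j"
    by (simp add: q_gram_def inner_fund_cut)
qed

lemma coeff_unimodular3: "unimodular3 T cotree coeff" "unimodular3 cotree T (\<lambda>j i. coeff i j)"
  using equitable_unimodular3[OF coeff_equitable] unimodular3_transpose by blast+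

lemma cycle_in_tree_and_edge:
  assumes "cycle_edge_set G S" "S \<subseteq> insert j T" and j: "j \<in> cotree"
  shows "S = supp (fund_cycle G T j)"
proof -
  obtain y where y: "is_flow G y" "supp y = S" "S \<noteq> {}" using cycle_edge_set_flow[OF assms(1)] by blast
  have "y e = y j * fund_cycle G T j e" for e
  proof (cases "e \<in> T")
    case True
    have out: "y k = 0" if "k \<in> cotree" "k \<noteq> j" for k
      using y(2) assms(2) that arcs_split(2) by blast
    have "(\<Sum>k\<in>cotree. y k * coeff e k) = (\<Sum>k\<in>{j}. y k * coeff e k)"
      using finite_cotree j out by (intro sum.mono_neutral_right) auto
    moreover have "y e = (\<Sum>k\<in>cotree. y k * coeff e k)" using y(1) True unfolding flow_iff by blast
    ultimately show ?thesis by (simp add: coeff_def)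
  next
    case False
    then show ?thesis
    proof (cases "e = j")
      case True then show ?thesis using fund_cycle_props(2)[OF j] by simp
    next
      case ne: False
      then have "y e = 0" using False y(2) assms(2) by blast
      then show ?thesis using fund_cycle_props(3)[OF j, of e] ne False by simp
    qed
  qed
  then have eq: "y = (\<lambda>e. y j * fund_cycle G T j e)" by blast
  have "y j \<noteq> 0"
  proof
    assume "y j = 0"
    then have "y = (\<lambda>e. 0)" using eq by simp
    then show False using y(2,3) by simp
  qed
  then have "supp y = supp (fund_cycle G T j)" by (subst eq) simp
  then show ?thesis using y(2) by simp
qed

end

locale two_trees_in_graphs = A: tree_in_graph G1 T1 + B: tree_in_graph G2 T2
  for G1 :: "('a, 'b) pre_digraph" and T1 and G2 :: "('c, 'd) pre_digraph" and T2
begin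

lemma gram_commute: "gram R D i j = gram R D j i"
  unfolding gram_def by (simp add: mult.commute)

lemma flow_lattices_isomorphic_iff:
  "q_lattices_isomorphic (q_flow_lattice G1 T1) (q_flow_lattice G2 T2) \<longleftrightarrow>
    signed_equiv T1 A.cotree A.coeff T2 B.cotree B.coeff"
  unfolding A.q_flow_lattice_gram B.q_flow_lattice_gram
  using free_q_lattices_isomorphic_iff[OF A.finite_cotree B.finite_cotree,
        where ?b1.0 = "gram T1 A.coeff" and ?b2.0 = "gram T2 B.coeff", OF gram_commute gram_commute]
    signed_equiv_iff_gram_equiv[OF A.coeff_unimodular3(1) A.finite_T B.coeff_unimodular3(1) B.finite_T A.finite_cotree
      A.tree_edge_in_cycle B.tree_edge_in_cycle]
  by blast

lemma cut_lattices_isomorphic_iff: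
  "q_lattices_isomorphic (q_cut_lattice G1 T1) (q_cut_lattice G2 T2) \<longleftrightarrow>
    signed_equiv T1 A.cotree A.coeff T2 B.cotree B.coeff"
  unfolding A.q_cut_lattice_gram B.q_cut_lattice_gram
  using free_q_lattices_isomorphic_iff[OF A.finite_T B.finite_T,
        where ?b1.0 = "gram A.cotree (\<lambda>j i. A.coeff i j)" and ?b2.0 = "gram B.cotree (\<lambda>j i. B.coeff i j)",
        OF gram_commute gram_commute]
    signed_equiv_iff_gram_equiv[OF A.coeff_unimodular3(2) A.finite_cotree B.coeff_unimodular3(2) B.finite_cotree A.finite_T
      A.cotree_edge_meets_tree B.cotree_edge_meets_tree]
    signed_equiv_transpose[of A.cotree T1 A.coeff B.cotree T2 B.coeff]
  by blast

text \<open>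
  The image of a fundamental cycle is a cycle in \<open>insert (F j) T2\<close>, hence a fundamental cycle. So the two
  coefficient matrices have the same support, which determines their signs.
\<close>

lemma signed_equiv_if_cycle_preserving:
  assumes F: "bij_betw F (arcs G1) (arcs G2)" and cp: "cycle_preserving G1 G2 F" and FT: "F ` T1 = T2"
  shows "signed_equiv T1 A.cotree A.coeff T2 B.cotree B.coeff"
proof -
  have inj: "inj_on F (arcs G1)" using F unfolding bij_betw_def by blast
  have FT': "bij_betw F T1 T2"
    using inj_on_subset[OF inj A.T_arcs] FT unfolding bij_betw_def by blast
  have "F ` A.cotree = arcs G2 - F ` T1"
    unfolding A.cotree_def using F inj_on_image_set_diff[OF inj, of "arcs G1" T1] A.T_arcs
    unfolding bij_betw_def by auto
  then have "F ` A.cotree = B.cotree" unfolding B.cotree_def FT .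
  moreover have "inj_on F A.cotree" using inj_on_subset[OF inj] unfolding A.cotree_def by blast
  ultimately have FC: "bij_betw F A.cotree B.cotree" unfolding bij_betw_def by blast
  have "signed_equiv A.cotree T1 (\<lambda>j i. A.coeff i j) B.cotree T2 (\<lambda>j i. B.coeff i j)"
  proof (rule signed_equiv_if_same_support[OF A.coeff_equitable B.coeff_equitable FC FT'])
    fix j i assume j: "j \<in> A.cotree" and i: "i \<in> T1"
    let ?Z = "supp (fund_cycle G1 T1 j)"
    have Fj: "F j \<in> B.cotree" using FC j by (rule bij_betw_apply)
    have Zsub: "?Z \<subseteq> insert j T1" using A.fund_cycle_props(3)[OF j] by blast
    then have ZG: "?Z \<subseteq> arcs G1" using j A.T_arcs unfolding A.cotree_def by blast
    have "cycle_edge_set G2 (F ` ?Z)"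
      using A.fund_cycle_props(4)[OF j] ZG cp unfolding cycle_preserving_def by blast
    moreover have "F ` ?Z \<subseteq> insert (F j) T2" using Zsub FT by blast
    ultimately have eq: "F ` ?Z = supp (fund_cycle G2 T2 (F j))"
      using B.cycle_in_tree_and_edge Fj by blast
    have "i \<in> ?Z \<longleftrightarrow> F i \<in> F ` ?Z"
      using inj_on_image_mem_iff[OF inj _ ZG] i A.T_arcs by blast
    then show "A.coeff i j = 0 \<longleftrightarrow> B.coeff (F i) (F j) = 0"
      unfolding eq A.coeff_def B.coeff_def by blast
  qed
  then show ?thesis using signed_equiv_transpose by blast
qed

text \<open>
  A flow is described by its values off the tree together with the coefficient matrix. A signed
  equivalence therefore carries flows to flows, along a bijection \<open>F\<close> of the edges and
  with signs \<open>\<theta>\<close>. Since cycles are the minimal supports of nonzero flows, \<open>F\<close> preserves them.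
\<close>

lemma cycle_preserving_if_signed_equiv:
  assumes "signed_equiv T1 A.cotree A.coeff T2 B.cotree B.coeff"
  shows "\<exists>F. bij_betw F (arcs G1) (arcs G2) \<and> cycle_preserving G1 G2 F \<and> F ` T1 = T2"
proof -
  obtain \<rho> \<sigma> \<eta> \<epsilon> where \<rho>: "bij_betw \<rho> T1 T2" and \<sigma>: "bij_betw \<sigma> A.cotree B.cotree"
    and \<eta>: "\<And>i. \<eta> i \<in> {-1, 1::int}" and \<epsilon>: "\<And>j. \<epsilon> j \<in> {-1, 1::int}"
    and eq: "\<And>i j. i \<in> T1 \<Longrightarrow> j \<in> A.cotree \<Longrightarrow> B.coeff (\<rho> i) (\<sigma> j) = \<eta> i * \<epsilon> j * A.coeff i j"
    using assms unfolding signed_equiv_def by blast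
  define F where "F e = (if e \<in> T1 then \<rho> e else \<sigma> e)" for e
  define \<theta> where "\<theta> e = (if e \<in> T1 then \<eta> e else \<epsilon> e)" for e
  have \<theta>: "\<theta> e \<in> {-1, 1}" "\<theta> e * \<theta> e = 1" for e
    using \<eta>[of e] \<epsilon>[of e] unfolding \<theta>_def by auto
  have notT: "j \<notin> T1" if "j \<in> A.cotree" for j using that A.arcs_split(2) by blast
  have FT: "bij_betw F T1 T2"
    using \<rho> by (subst bij_betw_cong[of T1 F \<rho>]) (simp_all add: F_def)
  have FC: "bij_betw F A.cotree B.cotree"
    using \<sigma> notT by (subst bij_betw_cong[of A.cotree F \<sigma>]) (simp_all add: F_def)
  have F: "bij_betw F (arcs G1) (arcs G2)"
    unfolding A.arcs_split(1) B.arcs_split(1) by (rule bij_betw_combine[OF FT FC B.arcs_split(2)])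
  have inj: "inj_on F (arcs G1)" using F unfolding bij_betw_def by blast
  have flows: "is_flow G1 x \<longleftrightarrow> is_flow G2 y"
    if out: "\<And>e. e \<notin> arcs G1 \<Longrightarrow> x e = 0" "\<And>e. e \<notin> arcs G2 \<Longrightarrow> y e = 0"
      and xy: "\<And>e. e \<in> arcs G1 \<Longrightarrow> y (F e) = \<theta> e * x e" for x y
  proof -
    have "(\<forall>i\<in>T1. x i = (\<Sum>j\<in>A.cotree. x j * A.coeff i j)) \<longleftrightarrow>
      (\<forall>i\<in>T1. y (F i) = (\<Sum>j\<in>B.cotree. y j * B.coeff (F i) j))"
    proof (rule ball_cong[OF refl])
      fix i assume i: "i \<in> T1"
      have "(\<Sum>j\<in>B.cotree. y j * B.coeff (F i) j) = (\<Sum>j\<in>A.cotree. y (F j) * B.coeff (F i) (F j))"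
        by (rule sum.reindex_bij_betw[OF FC, symmetric])
      also have "\<dots> = (\<Sum>j\<in>A.cotree. \<theta> i * (x j * A.coeff i j))"
      proof (rule sum.cong[OF refl])
        fix j assume j: "j \<in> A.cotree"
        have "y (F j) = \<epsilon> j * x j" using xy[of j] j notT[OF j] unfolding A.cotree_def \<theta>_def by simp
        moreover have "B.coeff (F i) (F j) = \<theta> i * \<epsilon> j * A.coeff i j"
          using eq[OF i j] i notT[OF j] unfolding F_def \<theta>_def by simp
        ultimately show "y (F j) * B.coeff (F i) (F j) = \<theta> i * (x j * A.coeff i j)"
          using \<epsilon>[of j] by auto
      qed
      also have "\<dots> = \<theta> i * (\<Sum>j\<in>A.cotree. x j * A.coeff i j)" by (rule sum_distrib_left[symmetric])
      finally have "(\<Sum>j\<in>B.cotree. y j * B.coeff (F i) j) = \<theta> i * (\<Sum>j\<in>A.cotree. x j * A.coeff i j)" .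
      moreover have "y (F i) = \<theta> i * x i" using xy[of i] i A.T_arcs by blast
      ultimately show "x i = (\<Sum>j\<in>A.cotree. x j * A.coeff i j) \<longleftrightarrow>
          y (F i) = (\<Sum>j\<in>B.cotree. y j * B.coeff (F i) j)"
        using \<theta>(1)[of i] by auto
    qed
    also have "\<dots> \<longleftrightarrow> (\<forall>i\<in>T2. y i = (\<Sum>j\<in>B.cotree. y j * B.coeff i j))"
      using FT unfolding bij_betw_def by blast
    finally show ?thesis unfolding A.flow_iff B.flow_iff using out by blast
  qed
  have supports: "supp y = F ` supp x"
    if out: "\<And>e. e \<notin> arcs G1 \<Longrightarrow> x e = 0" "\<And>e. e \<notin> arcs G2 \<Longrightarrow> y e = 0"
      and xy: "\<And>e. e \<in> arcs G1 \<Longrightarrow> y (F e) = \<theta> e * x e" for x y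
  proof (intro equalityI subsetI)
      fix d assume d: "d \<in> supp y"
      then have "d \<in> arcs G2" using out(2) by blast
      then obtain e where e: "e \<in> arcs G1" "d = F e" using F unfolding bij_betw_def by blast
      then have "x e \<noteq> 0" using d xy by auto
      then show "d \<in> F ` supp x" using e by blast
    next
      fix d assume "d \<in> F ` supp x"
      then obtain e where e: "x e \<noteq> 0" "d = F e" by blast
      then have "e \<in> arcs G1" using out(1) by blast
      then show "d \<in> supp y" using xy e \<theta>(1)[of e] by auto
    qed
  have push: "\<exists>y. is_flow G2 y \<and> supp y = F ` supp x" if x: "is_flow G1 x" for x
  proof -
    define y where "y d = (if d \<in> arcs G2 then \<theta> (inv_into (arcs G1) F d) * x (inv_into (arcs G1) F d) else 0)" for d
    have xout: "\<And>e. e \<notin> arcs G1 \<Longrightarrow> x e = 0" using x unfolding is_flow_def by blast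
    have yF: "y (F e) = \<theta> e * x e" if "e \<in> arcs G1" for e
      unfolding y_def using that inv_into_f_f[OF inj that] bij_betw_apply[OF F that] by simp
    have yout: "y d = 0" if "d \<notin> arcs G2" for d unfolding y_def using that by simp
    have "is_flow G2 y" using flows[OF xout yout yF] x by blast
    moreover have "supp y = F ` supp x" using supports[OF xout yout yF] .
    ultimately show ?thesis by blast
  qed
  have pull: "\<exists>x. is_flow G1 x \<and> supp y = F ` supp x" if y: "is_flow G2 y" for y
  proof -
    define x where "x e = (if e \<in> arcs G1 then \<theta> e * y (F e) else 0)" for e
    have yout: "\<And>e. e \<notin> arcs G2 \<Longrightarrow> y e = 0" using y unfolding is_flow_def by blast
    have xout: "x e = 0" if "e \<notin> arcs G1" for e unfolding x_def using that by simp
    have yF: "y (F e) = \<theta> e * x e" if "e \<in> arcs G1" for e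
      unfolding x_def using that \<theta>(2)[of e] by (simp flip: mult.assoc)
    have "is_flow G1 x" using flows[OF xout yout yF] y by blast
    moreover have "supp y = F ` supp x" using supports[OF xout yout yF] .
    ultimately show ?thesis by blast
  qed
  have "cycle_preserving G1 G2 F"
    unfolding cycle_preserving_def
  proof (intro allI impI iffI)
    fix S assume S: "S \<subseteq> arcs G1" and c: "cycle_edge_set G1 S"
    obtain x where x: "is_flow G1 x" "supp x = S" "S \<noteq> {}" using A.cycle_edge_set_flow[OF c] by blast
    obtain y where y: "is_flow G2 y" "supp y = F ` S" using push[OF x(1)] x(2) by blast
    then obtain d where "y d \<noteq> 0" using x(3) by blast
    then obtain Z where Z: "cycle_edge_set G2 Z" "Z \<subseteq> F ` S"
      using B.flow_contains_cycle[OF y(1)] y(2) by metis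
    obtain y' where y': "is_flow G2 y'" "supp y' = Z" "Z \<noteq> {}" using B.cycle_edge_set_flow[OF Z(1)] by blast
    obtain x' where x': "is_flow G1 x'" "Z = F ` supp x'" using pull[OF y'(1)] y'(2) by blast
    have "supp x' \<subseteq> arcs G1" using x'(1) unfolding is_flow_def by blast
    then have "supp x' \<subseteq> S" using Z(2) x'(2) inj_on_image_mem_iff[OF inj _ S] by blast
    then have "supp x' = S" using A.cycle_edge_set_minimal[OF c x'(1)] x'(2) y'(3) by blast
    then show "cycle_edge_set G2 (F ` S)" using Z(1) x'(2) by simp
  next
    fix S assume S: "S \<subseteq> arcs G1" and c: "cycle_edge_set G2 (F ` S)"
    obtain y where y: "is_flow G2 y" "supp y = F ` S" "F ` S \<noteq> {}" using B.cycle_edge_set_flow[OF c] by blast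
    obtain x where x: "is_flow G1 x" "F ` S = F ` supp x" using pull[OF y(1)] y(2) by auto
    have sub: "supp x \<subseteq> arcs G1" using x(1) unfolding is_flow_def by blast
    have xS: "supp x = S" using inj_on_image_eq_iff[OF inj S sub] x(2) by simp
    obtain e where "x e \<noteq> 0" using xS y(3) by blast
    then obtain Z where Z: "cycle_edge_set G1 Z" "Z \<subseteq> S"
      using A.flow_contains_cycle[OF x(1)] xS by metis
    obtain x' where x': "is_flow G1 x'" "supp x' = Z" "Z \<noteq> {}" using A.cycle_edge_set_flow[OF Z(1)] by blast
    obtain y' where y': "is_flow G2 y'" "supp y' = F ` Z" using push[OF x'(1)] x'(2) by blast
    have "supp y' = F ` S" using B.cycle_edge_set_minimal[OF c y'(1)] y'(2) Z(2) x'(3) by blast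
    then have "Z = S" using y'(2) inj_on_image_eq_iff[OF inj _ S, of Z] Z(2) S by simp
    then show "cycle_edge_set G1 S" using Z(1) by simp
  qed
  moreover have "F ` T1 = T2" using FT unfolding bij_betw_def by blast
  ultimately show ?thesis using F by blast
qed

lemma cycle_preserving_iff_signed_equiv:
  "(\<exists>F. bij_betw F (arcs G1) (arcs G2) \<and> cycle_preserving G1 G2 F \<and> F ` T1 = T2) \<longleftrightarrow>
    signed_equiv T1 A.cotree A.coeff T2 B.cotree B.coeff"
  using signed_equiv_if_cycle_preserving cycle_preserving_if_signed_equiv by blast

end

theorem theorem4p5:
  fixes G1 :: "('a, 'b) pre_digraph" and G2 :: "('c, 'd) pre_digraph"
    and T1 :: "'b set" and T2 :: "'d set"
  assumes "fin_digraph G1" and "loopfree_digraph G1" and "two_edge_connected G1"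
    and "fin_digraph G2" and "loopfree_digraph G2" and "two_edge_connected G2"
    and "spanning_tree_edges G1 T1" and "spanning_tree_edges G2 T2"
  shows "(q_lattices_isomorphic (q_flow_lattice G1 T1) (q_flow_lattice G2 T2) \<longleftrightarrow>
          (\<exists>F. bij_betw F (arcs G1) (arcs G2) \<and> cycle_preserving G1 G2 F \<and> F ` T1 = T2)) \<and>
         ((\<exists>F. bij_betw F (arcs G1) (arcs G2) \<and> cycle_preserving G1 G2 F \<and> F ` T1 = T2) \<longleftrightarrow>
          q_lattices_isomorphic (q_cut_lattice G1 T1) (q_cut_lattice G2 T2))"
proof -
  interpret two_trees_in_graphs G1 T1 G2 T2
    unfolding two_trees_in_graphs_def tree_in_graph_def tree_in_graph_axioms_def using assms by blast
  show ?thesis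
    using flow_lattices_isomorphic_iff cut_lattices_isomorphic_iff cycle_preserving_iff_signed_equiv by simp
qed

end
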